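(* Let $\mathcal{A}$ be a Mackey-complete hermitian continuous inverse algebra. Then for every $n\ge1$ and every $X\in\mathrm{Fl}_{\mathcal{A}}(n)$, the unitary group $\mathrm{U}(\mathcal{A})$ acts transitively on the flag manifold $\mathrm{Fl}_{\mathcal{A}}(X)$.
   Context: A continuous inverse algebra (CIA) is a Hausdorff locally convex unital associative (complex) algebra $\mathcal{A}$ with (jointly) continuous multiplication whose group of units $\mathcal{A}^\times$ is open and for which the inversion $\mathcal{A}^\times\to\mathcal{A}$, $a\mapsto a^{-1}$, is continuous. A locally convex space is Mackey-complete if every Mackey-Cauchy sequence converges; equivalently, the Riemann integral over $[0,1]$ of every smooth curve exists in the space. An involution is a conjugate-linear, anti-multiplicative map $a\mapsto a^*$ with $a^{**}=a$. The spectrum is $\sigma_{\mathcal{A}}(a)=\{\lambda\in\mathbb{C}\mid \lambda\mathbf{1}-a\notin\mathcal{A}^\times\}$. A hermitian algebra is a unital complex associative algebra endowed with an involution such that $\sigma_{\mathcal{A}}(a)\subseteq\mathbb{R}$ whenever $a=a^*$. The unitary group is $\mathrm{U}(\mathcal{A})=\{u\in\mathcal{A}^\times\mid u^*u=\mathbf{1}\}$. Flags. Let $\mathcal{P}(\mathcal{A})$ be the set of idempotents of $\mathcal{A}$ (not necessarily self-adjoint). For $p,q\in\mathcal{P}(\mathcal{A})$ write $p\le q$ if $qp=p$ (i.e. $p\mathcal{A}\subseteq q\mathcal{A}$), and $p\sim q$ if $pq=q$ and $qp=p$ (i.e. $p\mathcal{A}=q\mathcal{A}$). For $n\ge1$ let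 $\mathcal{P}_n(\mathcal{A})=\{(p_1,\dots,p_n)\in\mathcal{P}(\mathcal{A})^n\mid p_1\le\cdots\le p_n\}$, and let $\mathrm{Fl}_{\mathcal{A}}(n)=\mathcal{P}_n(\mathcal{A})/\sim$, where $(p_1,\dots,p_n)\sim(q_1,\dots,q_n)$ iff $p_j\sim q_j$ for all $j$. The class $[(p_1,\dots,p_n)]$ is identified with the tuple of right ideals $(p_1\mathcal{A},\dots,p_n\mathcal{A})$. The group $\mathcal{A}^\times$ acts on $\mathrm{Fl}_{\mathcal{A}}(n)$ by left multiplication, $g\cdot(p_1\mathcal{A},\dots,p_n\mathcal{A})=(gp_1\mathcal{A},\dots,gp_n\mathcal{A})$, i.e. $g\cdot[(p_j)_j]=[(gp_jg^{-1})_j]$. For $X\in\mathrm{Fl}_{\mathcal{A}}(n)$ the flag manifold $\mathrm{Fl}_{\mathcal{A}}(X)$ is the $\mathcal{A}^\times$-orbit of $X$; $\mathrm{U}(\mathcal{A})\subseteq\mathcal{A}^\times$ acts on it by restriction. *)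

theory Defs
  imports "HOL-Analysis.Analysis" "HOL-Algebra.Group_Action"
begin

section \<open>Complex algebras\<close>

text \<open>The real scaling is part of the structure and is the restriction of the complex one, so that
  notions for real vector spaces such as \<^const>\<open>convex\<close> apply.\<close>

class scaleC = scaleR +
  fixes scaleC :: "complex \<Rightarrow> 'a \<Rightarrow> 'a"  (infixr \<open>*\<^sub>C\<close> 75)
  assumes scaleR_scaleC: "scaleR r x = scaleC (complex_of_real r) x"

class complex_vector = scaleC + ab_group_add +
  assumes scaleC_add_right: "a *\<^sub>C (x + y) = a *\<^sub>C x + a *\<^sub>C y"
    and scaleC_add_left: "(a + b) *\<^sub>C x = a *\<^sub>C x + b *\<^sub>C x"
    and scaleC_scaleC: "a *\<^sub>C (b *\<^sub>C x) = (a * b) *\<^sub>C x"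
    and scaleC_one: "1 *\<^sub>C x = x"

subclass (in complex_vector) real_vector
  by standard
    (simp_all add: scaleR_scaleC scaleC_add_right scaleC_add_left scaleC_scaleC scaleC_one)

text \<open>Unital algebras are expressed by adding \<^class>\<open>monoid_mult\<close>; unlike \<^class>\<open>ring_1\<close>, this does
  not exclude the zero algebra.\<close>

class complex_algebra = complex_vector + ring +
  assumes mult_scaleC_left: "(a *\<^sub>C x) * y = a *\<^sub>C (x * y)"
    and mult_scaleC_right: "x * (a *\<^sub>C y) = a *\<^sub>C (x * y)"

definition (in monoid_mult) algebra_units :: "'a set"
  where "algebra_units = {a. \<exists>b. a * b = 1 \<and> b * a = 1}"

definition (in monoid_mult) algebra_inv :: "'a \<Rightarrow> 'a"
  where "algebra_inv a = (THE b. a * b = 1 \<and> b * a = 1)"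


section \<open>Continuous inverse algebras\<close>

class locally_convex_space = complex_vector + t2_space + topological_ab_group_add +
  assumes tendsto_scaleC_Pair:
      "LIM z (nhds c \<times>\<^sub>F nhds x). fst z *\<^sub>C snd z :> nhds (c *\<^sub>C x)"
    and locally_convex:
      "open U \<Longrightarrow> 0 \<in> U \<Longrightarrow> \<exists>V. open V \<and> 0 \<in> V \<and> V \<subseteq> U \<and>
        (\<forall>x\<in>V. \<forall>y\<in>V. \<forall>u\<ge>0. \<forall>v\<ge>0. u + v = 1 \<longrightarrow> u *\<^sub>R x + v *\<^sub>R y \<in> V)"

text \<open>The axiom above is an unfolded form of the following statement, since \<^const>\<open>convex\<close> cannot
  be used within the class specification.\<close>

lemma locally_convex_convex:
  fixes U :: "'a::locally_convex_space set"
  assumes "open U" "0 \<in> U"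
  shows "\<exists>V. open V \<and> convex V \<and> 0 \<in> V \<and> V \<subseteq> U"
  using locally_convex[OF assms] unfolding convex_def by blast

class continuous_inverse_algebra =
  locally_convex_space + complex_algebra + topological_monoid_mult +
  assumes open_algebra_units: "open algebra_units"
    and tendsto_algebra_inv: "a \<in> algebra_units \<Longrightarrow>
      (algebra_inv \<longlongrightarrow> algebra_inv a) (at a within algebra_units)"

lemma continuous_on_algebra_inv:
  "continuous_on algebra_units (algebra_inv :: 'a::continuous_inverse_algebra \<Rightarrow> 'a)"
  by (simp add: continuous_on_def tendsto_algebra_inv)


section \<open>Mackey completeness\<close>

definition (in locally_convex_space) von_neumann_bounded :: "'a set \<Rightarrow> bool"
  where "von_neumann_bounded B \<longleftrightarrow>
    (\<forall>U. open U \<and> 0 \<in> U \<longrightarrow> (\<exists>r>0. B \<subseteq> (\<lambda>x. r *\<^sub>R x) ` U))"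

definition (in locally_convex_space) Mackey_Cauchy :: "(nat \<Rightarrow> 'a) \<Rightarrow> bool"
  where "Mackey_Cauchy x \<longleftrightarrow>
    (\<exists>B t. von_neumann_bounded B \<and>
      (t \<longlongrightarrow> (0::real)) (sequentially \<times>\<^sub>F sequentially) \<and>
      (\<forall>m n. x m - x n \<in> (\<lambda>b. t (m, n) *\<^sub>R b) ` B))"

class Mackey_complete_space = locally_convex_space +
  assumes Mackey_Cauchy_convergent: "Mackey_Cauchy x \<Longrightarrow> convergent x"


section \<open>Hermitian algebras and the unitary group\<close>

definition is_involution :: "('a::{complex_algebra, monoid_mult} \<Rightarrow> 'a) \<Rightarrow> bool"
  where "is_involution star \<longleftrightarrow>
    (\<forall>a b. star (a + b) = star a + star b) \<and>
    (\<forall>c a. star (c *\<^sub>C a) = cnj c *\<^sub>C star a) \<and>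
    (\<forall>a b. star (a * b) = star b * star a) \<and>
    (\<forall>a. star (star a) = a)"

definition algebra_spectrum :: "'a::{complex_algebra, monoid_mult} \<Rightarrow> complex set"
  where "algebra_spectrum a = {z. z *\<^sub>C 1 - a \<notin> algebra_units}"

text \<open>The involution is not required to be continuous.\<close>

definition is_hermitian :: "('a::{complex_algebra, monoid_mult} \<Rightarrow> 'a) \<Rightarrow> bool"
  where "is_hermitian star \<longleftrightarrow>
    is_involution star \<and> (\<forall>a. star a = a \<longrightarrow> algebra_spectrum a \<subseteq> \<real>)"

definition unit_group :: "'a::monoid_mult monoid"
  where "unit_group = \<lparr>carrier = algebra_units, mult = (*), one = 1\<rparr>"

definition unitary_group :: "('a::monoid_mult \<Rightarrow> 'a) \<Rightarrow> 'a monoid"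
  where "unitary_group star =
    \<lparr>carrier = {u \<in> algebra_units. star u * u = 1}, mult = (*), one = 1\<rparr>"


section \<open>Flags\<close>

definition idempotents :: "'a::monoid_mult set"
  where "idempotents = {p. p * p = p}"

definition idem_le :: "'a::monoid_mult \<Rightarrow> 'a \<Rightarrow> bool"
  where "idem_le p q \<longleftrightarrow> q * p = p"

definition idem_sim :: "'a::monoid_mult \<Rightarrow> 'a \<Rightarrow> bool"
  where "idem_sim p q \<longleftrightarrow> p * q = q \<and> q * p = p"

definition idem_chains :: "nat \<Rightarrow> 'a::monoid_mult list set"
  where "idem_chains n = {ps. length ps = n \<and> set ps \<subseteq> idempotents \<and> successively idem_le ps}"

definition flag_rel :: "nat \<Rightarrow> ('a::monoid_mult list \<times> 'a list) set"
  where "flag_rel n = {(ps, qs) \<in> idem_chains n \<times> idem_chains n. list_all2 idem_sim ps qs}"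

definition Flags :: "nat \<Rightarrow> 'a::monoid_mult list set set"
  where "Flags n = idem_chains n // flag_rel n"

text \<open>The lift to equivalence classes of the action of units on chains by simultaneous
  conjugation, see \<open>flag_act_class\<close> below.\<close>

definition flag_act :: "nat \<Rightarrow> 'a::monoid_mult \<Rightarrow> 'a list set \<Rightarrow> 'a list set"
  where "flag_act n g X = (\<Union>ps\<in>X. flag_rel n `` {map (\<lambda>p. g * p * algebra_inv g) ps})"

definition flag_manifold :: "nat \<Rightarrow> 'a::monoid_mult list set \<Rightarrow> 'a list set set"
  where "flag_manifold n X = Group_Action.orbit unit_group (flag_act n) X"


subsection \<open>Well-definedness\<close>

lemma algebra_inv:
  fixes g :: "'a::monoid_mult"
  assumes "g \<in> algebra_units"
  shows "g * algebra_inv g = 1" "algebra_inv g * g = 1"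
proof -
  obtain b where b: "g * b = 1" "b * g = 1"
    using assms by (auto simp: algebra_units_def)
  have "\<exists>!c. g * c = 1 \<and> c * g = 1"
    using b by (metis mult.assoc mult.left_neutral mult.right_neutral)
  from theI'[OF this] show "g * algebra_inv g = 1" "algebra_inv g * g = 1"
    by (auto simp: algebra_inv_def)
qed

lemma idem_sim_iff_same_ideal:
  fixes p q :: "'a::monoid_mult"
  assumes "p \<in> idempotents" "q \<in> idempotents"
  shows "idem_sim p q \<longleftrightarrow> range ((*) p) = range ((*) q)"
proof
  assume "idem_sim p q"
  then have 1: "p * q = q" and 2: "q * p = p"
    by (auto simp: idem_sim_def)
  have "q * a \<in> range ((*) p)" "p * a \<in> range ((*) q)" for a
    using rangeI[of "(*) p" "q * a"] rangeI[of "(*) q" "p * a"]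
    by (simp_all add: mult.assoc[symmetric] 1 2)
  then show "range ((*) p) = range ((*) q)" by blast
next
  assume eq: "range ((*) p) = range ((*) q)"
  have "q \<in> range ((*) p)" "p \<in> range ((*) q)"
    using rangeI[of "(*) q" 1] rangeI[of "(*) p" 1] eq by auto
  then obtain a b where ab: "q = p * a" "p = q * b" by auto
  have "p * (p * a) = p * a" "q * (q * b) = q * b"
    using assms by (simp_all add: mult.assoc[symmetric] idempotents_def)
  then show "idem_sim p q"
    unfolding idem_sim_def ab[symmetric] by blast
qed

lemma equiv_flag_rel: "equiv (idem_chains n) (flag_rel n :: ('a::monoid_mult list \<times> _) set)"
proof (rule equivI)
  show "flag_rel n \<subseteq> idem_chains n \<times> (idem_chains n :: 'a list set)"
    by (auto simp: flag_rel_def)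
  show "refl_on (idem_chains n) (flag_rel n :: ('a list \<times> _) set)"
    by (auto simp: refl_on_def flag_rel_def idem_chains_def idempotents_def idem_sim_def
        intro!: list.rel_refl_strong)
  show "sym (flag_rel n :: ('a list \<times> _) set)"
    by (auto simp: sym_def flag_rel_def idem_sim_def list_all2_conv_all_nth)
  have "idem_sim p r" if "idem_sim p q" "idem_sim q r" for p q r :: 'a
    using that unfolding idem_sim_def by (metis mult.assoc)
  then have "list_all2 idem_sim ps rs"
    if "list_all2 idem_sim ps qs" "list_all2 idem_sim qs rs" for ps qs rs :: "'a list"
    using list_all2_trans[OF _ that] by blast
  then show "trans (flag_rel n :: ('a list \<times> _) set)"
    unfolding trans_def flag_rel_def by blast
qed

lemma
  fixes g :: "'a::monoid_mult"
  assumes g: "g \<in> algebra_units"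
  shows map_conj_idem_chains:
      "ps \<in> idem_chains n \<Longrightarrow> map (\<lambda>p. g * p * algebra_inv g) ps \<in> idem_chains n"
    and map_conj_flag_rel: "(ps, qs) \<in> flag_rel n \<Longrightarrow>
      (map (\<lambda>p. g * p * algebra_inv g) ps, map (\<lambda>p. g * p * algebra_inv g) qs) \<in> flag_rel n"
proof -
  let ?c = "\<lambda>p. g * p * algebra_inv g"
  have c: "?c p * ?c q = ?c (p * q)" for p q
    by (metis algebra_inv(2)[OF g] mult.assoc mult.right_neutral)
  have le: "idem_le (?c p) (?c q)" if "idem_le p q" for p q
    using that by (simp add: idem_le_def c)
  show *: "map ?c ps \<in> idem_chains n" if "ps \<in> idem_chains n" for ps
  proof -
    have "successively idem_le (map ?c ps)"
      using that unfolding successively_map idem_chains_def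
      by (auto intro: successively_mono[of idem_le ps] le)
    with that show ?thesis
      by (auto simp: idem_chains_def idempotents_def c)
  qed
  show "(map ?c ps, map ?c qs) \<in> flag_rel n" if "(ps, qs) \<in> flag_rel n"
    using that * by (auto simp: flag_rel_def list_all2_conv_all_nth idem_sim_def c)
qed

lemma flag_act_class:
  fixes g :: "'a::monoid_mult"
  assumes "g \<in> algebra_units" "ps \<in> idem_chains n"
  shows "flag_act n g (flag_rel n `` {ps}) =
    flag_rel n `` {map (\<lambda>p. g * p * algebra_inv g) ps}"
  unfolding flag_act_def
proof (rule UN_equiv_class[OF equiv_flag_rel _ assms(2)])
  show "(\<lambda>ps. flag_rel n `` {map (\<lambda>p. g * p * algebra_inv g) ps}) respects flag_rel n"
    by (intro congruentI equiv_class_eq[OF equiv_flag_rel] map_conj_flag_rel assms(1))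
qed

end

theory Submission
  imports Defs
begin

text \<open>Every flag is represented by a chain of self-adjoint idempotents, by Kaplansky's formula. If a unit
  \<open>g\<close> maps one such flag onto another, then \<open>g\<close> is block triangular with respect to the two chains, and its
  block diagonal part \<open>h\<close> is a unit that intertwines the idempotents. The polar decomposition
  \<open>h = u (h\<^sup>* h)\<^sup>1\<^sup>/\<^sup>2\<close> yields a unitary \<open>u\<close> that still intertwines them, since \<open>h\<^sup>* h\<close> commutes with the
  idempotents of the first chain.

  The square root exists because \<open>h\<^sup>* h\<close> has positive spectrum (the Shirali--Ford theorem), so that,
  after scaling, it is \<open>1 - x\<close> with \<open>x\<close> of spectral radius less than 1, and the binomial series
  converges by Mackey completeness. In place of the spectral radius formula it suffices to know that
  \<open>x\<^sup>n \<rightarrow> 0\<close> if \<open>1 - c x\<close> is invertible for \<open>\<bar>c\<bar> \<le> 1\<close>; this follows from the identity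
  \<open>(1 - x\<^sup>n)\<^sup>-\<^sup>1 = 1/n \<Sum>\<^sub>j (1 - \<zeta>\<^sup>j x)\<^sup>-\<^sup>1\<close>, \<open>\<zeta>\<close> a primitive \<open>n\<close>-th root of unity, without any vector-valued
  integration.\<close>

text \<open>A unit \<open>g\<close> that carries one flag to another only satisfies
  \<open>q * g * p = g * p\<close>, and the unitary part of such a \<open>g\<close> need not satisfy
  this again. For self-adjoint \<open>p\<close>, \<open>q\<close> the two-sided relation
  \<open>h * p = q * h\<close> has the adjoint \<open>p * star h = star h * q\<close>, so
  \<open>p\<close> commutes with \<open>star h * h\<close>; this is why both the flags and the unit
  are replaced before the polar decomposition. The analysis is shaped by two obstacles. Continuous
  seminorms need not be submultiplicative, so the spectral radius cannot be controlled by estimating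
  products; and the involution may be discontinuous, so a limit of self-adjoint elements is not
  self-adjoint a priori. Spectral statements are therefore phrased through the invertibility of
  elements \<open>1 - c x\<close>. The Shirali-Ford theorem rests on Ptak's inequality, which makes
  the spectral radius submultiplicative on pairs of self-adjoint elements; this in turn makes sums
  of positive elements positive.\<close>

section \<open>Scaling and units\<close>

lemma scaleC_zero_left [simp]: "0 *\<^sub>C x = (0::'a::complex_vector)"
  using scaleC_add_left[of 0 0 x] by simp

lemma scaleC_zero_right [simp]: "c *\<^sub>C 0 = (0::'a::complex_vector)"
  using scaleC_add_right[of c 0 "0::'a"] by simp

lemma scaleC_minus_left: "(- c) *\<^sub>C x = - (c *\<^sub>C (x::'a::complex_vector))"
  using scaleC_add_left[of c "-c" x] by (simp add: eq_neg_iff_add_eq_0 add.commute)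

lemma scaleC_minus_right: "c *\<^sub>C (- x) = - (c *\<^sub>C (x::'a::complex_vector))"
  using scaleC_add_right[of c x "-x"] by (simp add: eq_neg_iff_add_eq_0 add.commute)

lemma scaleC_diff_left: "(c - d) *\<^sub>C x = c *\<^sub>C x - d *\<^sub>C (x::'a::complex_vector)"
  using scaleC_add_left[of c "-d" x] by (simp add: scaleC_minus_left)

lemma scaleC_diff_right: "c *\<^sub>C (x - y) = c *\<^sub>C x - c *\<^sub>C (y::'a::complex_vector)"
  using scaleC_add_right[of c x "-y"] by (simp add: scaleC_minus_right)

lemma scaleC_sum_left: "(\<Sum>i\<in>I. f i) *\<^sub>C x = (\<Sum>i\<in>I. f i *\<^sub>C (x::'a::complex_vector))"
  by (induction I rule: infinite_finite_induct) (auto simp: scaleC_add_left)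

lemma scaleC_sum_right: "c *\<^sub>C (\<Sum>i\<in>I. f i) = (\<Sum>i\<in>I. c *\<^sub>C (f i::'a::complex_vector))"
  by (induction I rule: infinite_finite_induct) (auto simp: scaleC_add_right)

lemmas scaleC_linear = scaleC_add_left scaleC_add_right scaleC_diff_left scaleC_diff_right
  scaleC_minus_left scaleC_minus_right

declare scaleC_one [simp] scaleC_scaleC [simp] mult_scaleC_left [simp] mult_scaleC_right [simp]

lemma power_scaleC:
  "(c *\<^sub>C x) ^ n = c ^ n *\<^sub>C (x::'a::{complex_algebra, monoid_mult}) ^ n"
  by (induction n) (auto simp: mult.commute)

lemma power_telescope:
  fixes y :: "'a::{ring, monoid_mult}"
  shows "(1 - y) * (\<Sum>k<n. y ^ k) = 1 - y ^ n" "(\<Sum>k<n. y ^ k) * (1 - y) = 1 - y ^ n"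
proof -
  show "(1 - y) * (\<Sum>k<n. y ^ k) = 1 - y ^ n"
    by (induction n) (simp_all add: distrib_left left_diff_distrib[of 1 y "y ^ _"])
  show "(\<Sum>k<n. y ^ k) * (1 - y) = 1 - y ^ n"
    by (induction n) (simp_all add: distrib_right right_diff_distrib[of "y ^ _" 1 y] power_commutes)
qed

lemma algebra_unitI: "a * b = 1 \<Longrightarrow> b * a = 1 \<Longrightarrow> a \<in> algebra_units"
  unfolding algebra_units_def by blast

lemma algebra_inv_eqI:
  fixes a b :: "'a::monoid_mult"
  assumes "a * b = 1" "b * a = 1"
  shows "algebra_inv a = b"
  using algebra_inv[OF algebra_unitI[OF assms]] assms by (metis mult.assoc mult_1_left mult_1_right)

lemma one_unit [simp]: "1 \<in> algebra_units"
  by (rule algebra_unitI[of _ 1]) auto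

lemma unit_inv: "a \<in> algebra_units \<Longrightarrow> algebra_inv a \<in> algebra_units"
  by (rule algebra_unitI[OF algebra_inv(2,1)])

lemma unit_mult:
  fixes a b :: "'a::monoid_mult"
  assumes a: "a \<in> algebra_units" and b: "b \<in> algebra_units"
  shows "a * b \<in> algebra_units"
proof (rule algebra_unitI)
  show "a * b * (algebra_inv b * algebra_inv a) = 1"
    by (metis algebra_inv(1)[OF a] algebra_inv(1)[OF b] mult.assoc mult_1_right)
  show "algebra_inv b * algebra_inv a * (a * b) = 1"
    by (metis algebra_inv(2)[OF a] algebra_inv(2)[OF b] mult.assoc mult_1_right)
qed

lemma unit_mult_cancel_right:
  fixes a b :: "'a::monoid_mult"
  assumes b: "b \<in> algebra_units" and "a * b \<in> algebra_units"
  shows "a \<in> algebra_units"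
  using unit_mult[OF assms(2) unit_inv[OF b]] by (simp add: mult.assoc algebra_inv[OF b])

text \<open>\<open>b * a\<close> supplies a left inverse of \<open>a\<close> and
  \<open>a * c\<close> a right inverse, and the two then coincide. This serves for factorisations
  whose factors do not commute.\<close>

lemma unit_sandwich:
  fixes a b c :: "'a::monoid_mult"
  assumes l: "b * a \<in> algebra_units" and r: "a * c \<in> algebra_units"
  shows "a \<in> algebra_units"
proof -
  define l' r' where "l' = algebra_inv (b * a) * b" and "r' = c * algebra_inv (a * c)"
  have 1: "l' * a = 1" and 2: "a * r' = 1"
    using algebra_inv(2)[OF l] algebra_inv(1)[OF r] by (simp_all add: l'_def r'_def mult.assoc)
  then have "l' = r'" by (metis mult.assoc mult_1_left mult_1_right)
  with 1 2 show ?thesis by (auto intro: algebra_unitI)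
qed

lemma unit_commuting_factor:
  fixes a b :: "'a::monoid_mult"
  assumes "a * b \<in> algebra_units" "a * b = b * a"
  shows "a \<in> algebra_units"
  using unit_sandwich[of b a b] assms by simp

lemma unit_scaleC_iff [simp]:
  fixes a :: "'a::{complex_algebra, monoid_mult}"
  assumes "c \<noteq> 0"
  shows "c *\<^sub>C a \<in> algebra_units \<longleftrightarrow> a \<in> algebra_units"
proof -
  have *: "d *\<^sub>C b \<in> algebra_units" if "d \<noteq> 0" "b \<in> algebra_units" for d and b :: 'a
    by (rule algebra_unitI[of _ "inverse d *\<^sub>C algebra_inv b"])
      (use that in \<open>simp_all add: algebra_inv\<close>)
  from *[of "inverse c" "c *\<^sub>C a"] *[OF assms, of a] assms show ?thesis by auto
qed

text \<open>Jacobson's formula: the geometric series suggests the inverse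
  \<open>1 + b * c * a\<close>, with \<open>c\<close> the inverse of
  \<open>1 - a * b\<close>.\<close>

lemma unit_one_diff_swap:
  fixes a b :: "'a::{ring, monoid_mult}"
  assumes u: "1 - a * b \<in> algebra_units"
  shows "1 - b * a \<in> algebra_units"
proof -
  define c where "c = algebra_inv (1 - a * b)"
  have c: "c - a * b * c = 1" "c - c * a * b = 1"
    using algebra_inv[OF u] by (simp_all add: c_def algebra_simps)
  have eq: "a * (b * (c * x)) = c * x - x" "c * (a * (b * x)) = c * x - x" for x
    using arg_cong[OF c(1), of "\<lambda>y. y * x"] arg_cong[OF c(2), of "\<lambda>y. y * x"]
    by (simp_all add: algebra_simps)
  show ?thesis
    by (rule algebra_unitI[of _ "1 + b * c * a"]) (simp_all add: algebra_simps eq)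
qed

lemma algebra_inv_commute:
  fixes a x :: "'a::monoid_mult"
  assumes "a \<in> algebra_units" "a * x = x * a"
  shows "algebra_inv a * x = x * algebra_inv a"
  by (metis algebra_inv[OF assms(1)] assms(2) mult.assoc mult_1_left mult_1_right)

lemma algebra_inv_mult:
  fixes a b :: "'a::monoid_mult"
  assumes a: "a \<in> algebra_units" and b: "b \<in> algebra_units"
  shows "algebra_inv (a * b) = algebra_inv b * algebra_inv a"
proof (rule algebra_inv_eqI)
  show "a * b * (algebra_inv b * algebra_inv a) = 1"
    by (metis algebra_inv(1)[OF a] algebra_inv(1)[OF b] mult.assoc mult_1_right)
  show "algebra_inv b * algebra_inv a * (a * b) = 1"
    by (metis algebra_inv(2)[OF a] algebra_inv(2)[OF b] mult.assoc mult_1_right)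
qed

lemma power_commuting_mult:
  fixes a b :: "'a::monoid_mult"
  assumes "a * b = b * a"
  shows "(a * b) ^ n = a ^ n * b ^ n"
proof (induction n)
  case (Suc n)
  have "b * a ^ n = a ^ n * b" using power_commuting_commutes[OF assms] by simp
  with Suc show ?case by (simp add: mult.assoc) (simp add: mult.assoc[symmetric])
qed simp

section \<open>Continuous seminorms\<close>

lemma tendsto_scaleC [tendsto_intros]:
  fixes g :: "'b \<Rightarrow> 'a::locally_convex_space"
  assumes "(f \<longlongrightarrow> c) F" "(g \<longlongrightarrow> x) F"
  shows "((\<lambda>z. f z *\<^sub>C g z) \<longlongrightarrow> c *\<^sub>C x) F"
proof -
  have "filterlim (\<lambda>z. (f z, g z)) (nhds c \<times>\<^sub>F nhds x) F"
    using tendsto_Pair[OF assms] by (simp add: nhds_prod)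
  from filterlim_compose[OF tendsto_scaleC_Pair this] show ?thesis by simp
qed

lemma continuous_on_scaleC [continuous_intros]:
  fixes g :: "'b::topological_space \<Rightarrow> 'a::locally_convex_space"
  shows "continuous_on S f \<Longrightarrow> continuous_on S g \<Longrightarrow> continuous_on S (\<lambda>z. f z *\<^sub>C g z)"
  by (auto simp: continuous_on_def intro: tendsto_intros)

text \<open>Continuity is demanded only at 0; the reverse triangle inequality spreads it to all
  points.\<close>

definition continuous_seminorm :: "('a::locally_convex_space \<Rightarrow> real) \<Rightarrow> bool"
  where "continuous_seminorm p \<longleftrightarrow> (\<forall>x y. p (x + y) \<le> p x + p y) \<and>
    (\<forall>c x. p (c *\<^sub>C x) = norm c * p x) \<and> (\<forall>e>0. \<forall>\<^sub>F x in nhds 0. p x < e)"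

locale cont_seminorm =
  fixes p :: "'a::locally_convex_space \<Rightarrow> real"
  assumes cont_seminorm: "continuous_seminorm p"
begin

lemma add: "p (x + y) \<le> p x + p y"
  and scale: "p (c *\<^sub>C x) = norm c * p x"
  and small: "e > 0 \<Longrightarrow> \<forall>\<^sub>F x in nhds 0. p x < e"
  using cont_seminorm by (auto simp: continuous_seminorm_def)

lemma zero [simp]: "p 0 = 0"
  using scale[of 0 0] by simp

lemma minus [simp]: "p (- x) = p x"
  using scale[of "-1" x] by (simp add: scaleC_minus_left)

lemma nonneg [simp]: "p x \<ge> 0"
  using add[of x "-x"] by simp

lemma minus_commute: "p (x - y) = p (y - x)"
  using minus[of "x - y"] by simp

lemma abs_diff: "\<bar>p x - p y\<bar> \<le> p (x - y)"
  using add[of "x - y" y] add[of "y - x" x] minus_commute[of x y] by simp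

lemma sum: "p (\<Sum>i\<in>I. f i) \<le> (\<Sum>i\<in>I. p (f i))"
proof (induction I rule: infinite_finite_induct)
  case (insert i I)
  then show ?case using add[of "f i" "sum f I"] by simp
qed auto

lemma tendsto_diff:
  assumes "(f \<longlongrightarrow> l) F"
  shows "((\<lambda>z. p (f z - l)) \<longlongrightarrow> 0) F"
proof (rule tendstoI)
  fix e :: real
  assume "e > 0"
  have "((\<lambda>z. f z - l) \<longlongrightarrow> 0) F"
    using tendsto_diff[OF assms tendsto_const[of l]] by simp
  from filterlim_iff[THEN iffD1, OF this, rule_format, OF small[OF \<open>e > 0\<close>]]
  show "\<forall>\<^sub>F z in F. dist (p (f z - l)) 0 < e" by simp
qed

lemma tendsto:
  assumes "(f \<longlongrightarrow> l) F"
  shows "((\<lambda>z. p (f z)) \<longlongrightarrow> p l) F"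
proof (rule Lim_transform)
  show "((\<lambda>z. p l) \<longlongrightarrow> p l) F" by simp
  show "((\<lambda>z. p (f z) - p l) \<longlongrightarrow> 0) F"
    by (rule tendsto_rabs_zero_cancel, rule tendsto_sandwich[OF _ _ tendsto_const tendsto_diff[OF assms]])
      (auto simp: abs_diff)
qed

lemma continuous_on: "continuous_on S f \<Longrightarrow> continuous_on S (\<lambda>z. p (f z))"
  by (auto simp: continuous_on_def intro: tendsto)

lemma bounded_on_compact:
  assumes "compact S" "continuous_on S f"
  shows "\<exists>M>0. \<forall>z\<in>S. p (f z) \<le> M"
proof -
  have "bdd_above ((\<lambda>z. p (f z)) ` S)"
    using compact_continuous_image[OF continuous_on[OF assms(2)] assms(1)]
    by (simp add: bounded_imp_bdd_above compact_imp_bounded)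
  then obtain M where "\<forall>z\<in>S. p (f z) \<le> M" by (auto simp: bdd_above_def)
  then have "\<forall>z\<in>S. p (f z) \<le> max M 1" by auto
  then show ?thesis by (intro exI[of _ "max M 1"]) auto
qed

end

text \<open>\<open>p\<close> is the Minkowski functional of \<open>C\<close>. Convexity gives the
  triangle inequality, balancedness the complex homogeneity, and the neighbourhood property
  finiteness and continuity.\<close>

lemma continuous_seminorm_gauge:
  fixes C :: "'a::locally_convex_space set"
  assumes conv: "convex C" and bal: "\<And>c x. norm c \<le> 1 \<Longrightarrow> x \<in> C \<Longrightarrow> c *\<^sub>C x \<in> C"
    and nhd: "\<forall>\<^sub>F x in nhds 0. x \<in> C"
  shows "\<exists>p. continuous_seminorm p \<and> (\<forall>x. p x < 1 \<longrightarrow> x \<in> C)"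
proof -
  define S where "S x = {t::real. t > 0 \<and> complex_of_real (1 / t) *\<^sub>C x \<in> C}" for x
  define p where "p x = Inf (S x)" for x
  have ev: "\<forall>\<^sub>F x in nhds 0. c *\<^sub>C x \<in> C" for c
  proof -
    have "((\<lambda>x. c *\<^sub>C x) \<longlongrightarrow> c *\<^sub>C 0) (nhds (0::'a))"
      by (intro tendsto_intros filterlim_ident)
    with nhd show ?thesis by (auto simp: filterlim_iff)
  qed
  have S_mono: "s \<in> S x" if "t \<in> S x" "t \<le> s" for s t x
  proof -
    have "complex_of_real (1 / s) *\<^sub>C x = complex_of_real (t / s) *\<^sub>C complex_of_real (1 / t) *\<^sub>C x"
      using that by (simp add: S_def)
    also have "\<dots> \<in> C"
      using that by (rule_tac bal) (simp_all add: S_def norm_divide)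
    finally show ?thesis using that by (simp add: S_def)
  qed
  have S_ne: "S x \<noteq> {}" for x
  proof -
    have "((\<lambda>n. complex_of_real (inverse (real (Suc n))) *\<^sub>C x) \<longlongrightarrow> complex_of_real 0 *\<^sub>C x) sequentially"
      by (intro tendsto_intros LIMSEQ_inverse_real_of_nat)
    then have "filterlim (\<lambda>n. complex_of_real (inverse (real (Suc n))) *\<^sub>C x) (nhds 0) sequentially"
      by simp
    with nhd have "\<forall>\<^sub>F n in sequentially. complex_of_real (inverse (real (Suc n))) *\<^sub>C x \<in> C"
      unfolding filterlim_iff by blast
    then obtain n where "complex_of_real (inverse (real (Suc n))) *\<^sub>C x \<in> C"
      by (auto simp: eventually_sequentially)
    then have "real (Suc n) \<in> S x" by (simp add: S_def inverse_eq_divide)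
    then show ?thesis by blast
  qed
  have bdd: "bdd_below (S x)" for x
    by (rule bdd_belowI[of _ 0]) (auto simp: S_def)
  have p_less: "s \<in> S x" if "p x < s" for s x
    using cInf_lessD[OF S_ne, of x s] that S_mono unfolding p_def by (meson less_imp_le)
  have p_le: "p x \<le> s" if "s \<in> S x" for s x
    unfolding p_def by (rule cInf_lower[OF that bdd])
  have p_nonneg: "p x \<ge> 0" for x
    unfolding p_def by (rule cInf_greatest[OF S_ne]) (auto simp: S_def)
  have p_add: "p (x + y) \<le> p x + p y" for x y
  proof (rule field_le_epsilon)
    fix e :: real assume "e > 0"
    define s t where "s = p x + e / 2" and "t = p y + e / 2"
    have s: "s \<in> S x" and t: "t \<in> S y" using \<open>e > 0\<close> by (auto simp: s_def t_def intro: p_less)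
    then have pos: "s > 0" "t > 0" by (auto simp: S_def)
    have "(s / (s + t)) *\<^sub>R (complex_of_real (1 / s) *\<^sub>C x) +
        (t / (s + t)) *\<^sub>R (complex_of_real (1 / t) *\<^sub>C y) \<in> C"
      using s t pos by (intro convexD[OF conv]) (auto simp: S_def add_divide_distrib[symmetric])
    also have "(s / (s + t)) *\<^sub>R (complex_of_real (1 / s) *\<^sub>C x) +
        (t / (s + t)) *\<^sub>R (complex_of_real (1 / t) *\<^sub>C y) = complex_of_real (1 / (s + t)) *\<^sub>C (x + y)"
      using pos by (simp add: scaleR_scaleC scaleC_add_right flip: of_real_add of_real_mult of_real_divide)
    finally have "s + t \<in> S (x + y)" using pos by (simp add: S_def)
    from p_le[OF this] show "p (x + y) \<le> p x + p y + e" by (simp add: s_def t_def)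
  qed
  have p_scale_le: "p (c *\<^sub>C x) \<le> norm c * p x" if "c \<noteq> 0" for c x
  proof (rule field_le_epsilon)
    fix e :: real assume "e > 0"
    define s where "s = p x + e / norm c"
    have s: "s \<in> S x" using \<open>e > 0\<close> that by (auto simp: s_def intro: p_less)
    then have "s > 0" by (auto simp: S_def)
    have "(c / norm c) *\<^sub>C complex_of_real (1 / s) *\<^sub>C x \<in> C"
      using s that by (rule_tac bal) (auto simp: S_def norm_divide)
    also have "(c / norm c) *\<^sub>C complex_of_real (1 / s) *\<^sub>C x = complex_of_real (1 / (norm c * s)) *\<^sub>C c *\<^sub>C x"
      by (simp add: field_simps)
    finally have "norm c * s \<in> S (c *\<^sub>C x)" using \<open>s > 0\<close> that by (simp add: S_def)
    from p_le[OF this] show "p (c *\<^sub>C x) \<le> norm c * p x + e"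
      using that by (simp add: s_def distrib_left)
  qed
  have p_scale: "p (c *\<^sub>C x) = norm c * p x" for c x
  proof (cases "c = 0")
    case True
    have "0 \<in> C" using eventually_nhds_x_imp_x[OF nhd] .
    then have "p 0 \<le> t" if "t > 0" for t using that by (intro p_le) (simp add: S_def)
    then have "p 0 \<le> 0" by (rule field_le_epsilon) simp
    with p_nonneg[of 0] True show ?thesis by simp
  next
    case False
    have "p x \<le> norm (inverse c) * p (c *\<^sub>C x)"
      using p_scale_le[of "inverse c" "c *\<^sub>C x"] False by simp
    with p_scale_le[OF False, of x] False show ?thesis
      by (simp add: norm_divide field_simps)
  qed
  have "\<forall>\<^sub>F x in nhds 0. p x < e" if "e > 0" for e
    using ev[of "complex_of_real (1 / (e / 2))"]
  proof eventually_elim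
    case (elim x)
    then have "p x \<le> e / 2" using that by (intro p_le) (simp add: S_def)
    with that show ?case by simp
  qed
  moreover have "x \<in> C" if "p x < 1" for x
    using p_less[OF that] by (simp add: S_def)
  ultimately show ?thesis
    using p_add p_scale by (intro exI[of _ p]) (auto simp: continuous_seminorm_def)
qed

text \<open>Local convexity provides convex neighbourhoods, but a complex homogeneous gauge needs a
  balanced one. By joint continuity of the scaling at the origin, a disc of scalars times a
  neighbourhood lies in \<open>V\<close>; these products form the balanced set \<open>B\<close>,
  whose convex hull is balanced and still inside \<open>V\<close>.\<close>

lemma continuous_seminorm_exists:
  fixes U :: "'a::locally_convex_space set"
  assumes "open U" "0 \<in> U"
  shows "\<exists>p. continuous_seminorm p \<and> (\<forall>x. p x < 1 \<longrightarrow> x \<in> U)"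
proof -
  obtain V where V: "open V" "convex V" "0 \<in> V" "V \<subseteq> U"
    using locally_convex_convex[OF assms] by blast
  have "\<forall>\<^sub>F z in nhds (0::complex) \<times>\<^sub>F nhds (0::'a). fst z *\<^sub>C snd z \<in> V"
    using tendsto_scaleC_Pair[of 0 "0::'a"] V by (auto simp: filterlim_iff eventually_nhds)
  then obtain Pf Pg where P: "eventually Pf (nhds (0::complex))" "eventually Pg (nhds (0::'a))"
      "\<And>c x. Pf c \<Longrightarrow> Pg x \<Longrightarrow> c *\<^sub>C x \<in> V"
    unfolding eventually_prod_filter by auto
  obtain d where d: "d > 0" "\<And>c. norm c < d \<Longrightarrow> Pf c"
    using P(1) by (auto simp: eventually_nhds_metric)
  define B where "B = {c *\<^sub>C x | c x. norm c < d \<and> Pg x}"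
  define C where "C = convex hull B"
  have "B \<subseteq> V" using P(3) d by (auto simp: B_def)
  then have "C \<subseteq> U" using V hull_minimal[of B V convex] by (auto simp: C_def)
  have bal: "c *\<^sub>C x \<in> C" if c: "norm c \<le> 1" and x: "x \<in> C" for c x
  proof -
    have "C \<subseteq> {x. c *\<^sub>C x \<in> C}"
      unfolding C_def
    proof (rule hull_minimal)
      show "B \<subseteq> {x. c *\<^sub>C x \<in> convex hull B}"
      proof
        fix b assume "b \<in> B"
        then obtain e y where b: "b = e *\<^sub>C y" "norm e < d" "Pg y" by (auto simp: B_def)
        have "norm (c * e) \<le> 1 * norm e"
          unfolding norm_mult using c by (intro mult_right_mono) auto
        with b have "c *\<^sub>C b \<in> B" unfolding B_def by (intro CollectI exI[of _ "c * e"] exI[of _ y]) auto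
        then show "b \<in> {x. c *\<^sub>C x \<in> convex hull B}" by (auto intro: hull_inc)
      qed
      show "convex {x. c *\<^sub>C x \<in> convex hull B}"
      proof (rule convexI)
        fix x y and u v :: real
        assume "x \<in> {x. c *\<^sub>C x \<in> convex hull B}" "y \<in> {x. c *\<^sub>C x \<in> convex hull B}"
          and uv: "0 \<le> u" "0 \<le> v" "u + v = 1"
        then have "u *\<^sub>R (c *\<^sub>C x) + v *\<^sub>R (c *\<^sub>C y) \<in> convex hull B"
          by (intro convexD[OF convex_convex_hull]) auto
        then show "u *\<^sub>R x + v *\<^sub>R y \<in> {x. c *\<^sub>C x \<in> convex hull B}"
          by (simp add: scaleR_scaleC scaleC_add_right mult.commute[of c])
      qed
    qed
    with x show ?thesis by auto
  qed
  \<comment> \<open>\<open>x\<close> is \<open>d / 2\<close> times \<open>(2 / d) x\<close>, and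
    \<open>d / 2\<close> has modulus below \<open>d\<close>; so \<open>x\<close> lies in
    \<open>B\<close> as soon as \<open>(2 / d) x\<close> satisfies \<open>Pg\<close>.\<close>
  have "((\<lambda>x. complex_of_real (2 / d) *\<^sub>C x) \<longlongrightarrow> complex_of_real (2 / d) *\<^sub>C 0) (nhds (0::'a))"
    by (intro tendsto_intros filterlim_ident)
  with P(2) have "\<forall>\<^sub>F x in nhds 0. Pg (complex_of_real (2 / d) *\<^sub>C x)"
    by (auto simp: filterlim_iff)
  then have "\<forall>\<^sub>F x in nhds 0. x \<in> C"
  proof eventually_elim
    case (elim x)
    have "complex_of_real (d / 2) *\<^sub>C complex_of_real (2 / d) *\<^sub>C x \<in> B"
      unfolding B_def using elim d(1)
      by (intro CollectI exI[of _ "complex_of_real (d / 2)"] exI[of _ "complex_of_real (2 / d) *\<^sub>C x"])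
        (simp add: norm_divide)
    moreover have "complex_of_real (d / 2) *\<^sub>C complex_of_real (2 / d) *\<^sub>C x = x"
      using d(1) by (simp flip: of_real_mult)
    ultimately show ?case by (auto simp: C_def intro: hull_inc)
  qed
  from continuous_seminorm_gauge[OF _ bal this] \<open>C \<subseteq> U\<close> show ?thesis
    by (auto simp: C_def)
qed

lemma tendsto_seminormI:
  fixes l :: "'a::locally_convex_space"
  assumes "\<And>p. continuous_seminorm p \<Longrightarrow> ((\<lambda>z. p (f z - l)) \<longlongrightarrow> 0) F"
  shows "(f \<longlongrightarrow> l) F"
proof (rule topological_tendstoI)
  fix S assume S: "open S" "l \<in> S"
  have "open ((\<lambda>x. x + l) -` S)"
    using S(1) by (intro open_vimage continuous_intros)
  moreover have "0 \<in> (\<lambda>x. x + l) -` S" using S by simp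
  ultimately obtain p where p: "continuous_seminorm p" "\<And>x. p x < 1 \<Longrightarrow> x + l \<in> S"
    using continuous_seminorm_exists by (metis vimageE)
  have "\<forall>\<^sub>F z in F. p (f z - l) < 1"
    using order_tendstoD(2)[OF assms[OF p(1)], of 1] by simp
  then show "\<forall>\<^sub>F z in F. f z \<in> S"
    by eventually_elim (use p(2) in force)
qed

lemma von_neumann_boundedI:
  fixes B :: "'a::locally_convex_space set"
  assumes "\<And>p. continuous_seminorm p \<Longrightarrow> \<exists>M. \<forall>b\<in>B. p b \<le> M"
  shows "von_neumann_bounded B"
  unfolding von_neumann_bounded_def
proof safe
  fix U :: "'a set" assume "open U" "0 \<in> U"
  then obtain p where p: "continuous_seminorm p" "\<And>x. p x < 1 \<Longrightarrow> x \<in> U"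
    using continuous_seminorm_exists by blast
  then interpret cont_seminorm p by unfold_locales
  obtain M where M: "\<And>b. b \<in> B \<Longrightarrow> p b \<le> M" using assms[OF p(1)] by auto
  define r where "r = \<bar>M\<bar> + 1"
  have "b \<in> (*\<^sub>R) r ` U" if "b \<in> B" for b
  proof
    show "b = r *\<^sub>R (inverse r *\<^sub>R b)" by (simp add: r_def)
    have "p (inverse r *\<^sub>R b) = inverse r * p b"
      by (simp add: scaleR_scaleC scale r_def norm_inverse)
    also have "\<dots> < 1" using M[OF that] by (simp add: r_def field_simps)
    finally show "inverse r *\<^sub>R b \<in> U" by (rule p(2))
  qed
  then show "\<exists>r>0. B \<subseteq> (*\<^sub>R) r ` U" by (intro exI[of _ r]) (auto simp: r_def)
qed

section \<open>Resolvents and powers\<close>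

lemma tendsto_algebra_inv_compose:
  fixes a :: "'a::continuous_inverse_algebra"
  assumes "(f \<longlongrightarrow> a) F" "a \<in> algebra_units"
  shows "((\<lambda>z. algebra_inv (f z)) \<longlongrightarrow> algebra_inv a) F"
  by (rule continuous_on_tendsto_compose[OF continuous_on_algebra_inv assms])
    (use topological_tendstoD[OF assms(1) open_algebra_units assms(2)] in simp)

text \<open>For \<open>R > 0\<close> this says that the spectrum of \<open>x\<close> lies in the
  open disc of radius \<open>1 / R\<close>. The parameters \<open>c\<close> fill a closed disc so
  that compactness can be used.\<close>

definition resolvent_disc :: "real \<Rightarrow> 'a::{complex_algebra, monoid_mult} \<Rightarrow> bool"
  where "resolvent_disc R x \<longleftrightarrow> (\<forall>c. norm c \<le> R \<longrightarrow> 1 - c *\<^sub>C x \<in> algebra_units)"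

lemma resolvent_discD: "resolvent_disc R x \<Longrightarrow> norm c \<le> R \<Longrightarrow> 1 - c *\<^sub>C x \<in> algebra_units"
  by (simp add: resolvent_disc_def)

lemma resolvent_disc_scale:
  assumes "resolvent_disc R x" "norm c * S \<le> R"
  shows "resolvent_disc S (c *\<^sub>C x)"
  unfolding resolvent_disc_def
proof safe
  fix d :: complex assume "norm d \<le> S"
  then have "norm (d * c) \<le> norm c * S"
    by (simp add: norm_mult mult.commute[of "norm d"] mult_left_mono)
  with assms show "1 - d *\<^sub>C c *\<^sub>C x \<in> algebra_units"
    by (auto simp: resolvent_disc_def)
qed

lemma resolvent_disc_swap:
  "resolvent_disc R (x * y) \<Longrightarrow> resolvent_disc R (y * x)"
  using unit_one_diff_swap[of "_ *\<^sub>C x" y] by (auto simp: resolvent_disc_def)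

text \<open>The compact disc lies in an open set of good parameters and so has a uniform margin
  \<open>e\<close>. This later turns radius 1 into a radius above 1, and hence into geometric decay
  of powers.\<close>

lemma resolvent_disc_extend:
  fixes x :: "'a::continuous_inverse_algebra"
  assumes x: "resolvent_disc R x" and R: "R \<ge> 0"
  shows "\<exists>S>R. resolvent_disc S x"
proof -
  define W where "W = (\<lambda>c. 1 - c *\<^sub>C x) -` algebra_units"
  have "open W"
    unfolding W_def by (intro open_vimage open_algebra_units continuous_intros)
  moreover have "cball 0 R \<subseteq> W"
    using x by (auto simp: W_def resolvent_disc_def)
  ultimately obtain e where e: "e > 0" "(\<Union>c\<in>cball 0 R. cball c e) \<subseteq> W"
    using compact_subset_open_imp_cball_epsilon_subset[of "cball 0 R" W] by auto
  have "c \<in> W" if "norm c \<le> R + e" for c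
  proof (cases "norm c \<le> R")
    case False
    \<comment> \<open>The radial projection of \<open>c\<close> to the circle of radius
      \<open>R\<close>, at distance \<open>norm c - R\<close> from \<open>c\<close>.\<close>
    define d where "d = of_real (R / norm c) * c"
    have "norm c > 0" using False R by linarith
    then have "norm d = R" using R by (simp add: d_def norm_mult norm_divide)
    moreover have "c - d = of_real (1 - R / norm c) * c"
      by (simp add: d_def left_diff_distrib)
    then have "norm (c - d) = norm c - R"
      using False R \<open>norm c > 0\<close>
      by (simp only: norm_mult norm_of_real) (simp add: abs_if field_simps)
    ultimately show ?thesis using e(2) that
      by (intro subsetD[OF e(2)] UN_I[of d]) (auto simp: dist_norm norm_minus_commute)
  qed (use \<open>cball 0 R \<subseteq> W\<close> in auto)
  then show ?thesis using e(1) by (intro exI[of _ "R + e"]) (auto simp: resolvent_disc_def W_def)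
qed

lemma resolvent_disc_exists:
  fixes x :: "'a::continuous_inverse_algebra"
  shows "\<exists>R>0. resolvent_disc R x"
  \<comment> \<open>The disc of radius 0 contains only \<open>c = 0\<close>, where
    \<open>1 - c x\<close> is 1; extending it gives a positive radius.\<close>
  by (rule resolvent_disc_extend) (auto simp: resolvent_disc_def)

lemma sum_powers_root_of_unity:
  assumes "0 < k" "k < N"
  shows "(\<Sum>j<N. (cis (2 * pi / N) ^ j) ^ k) = 0"
proof -
  let ?w = "cis (2 * pi / N)"
  have eq: "?w ^ k = cis (2 * pi * real k / real N)"
    unfolding Complex.DeMoivre by (simp add: mult.commute)
  have "inj_on (\<lambda>k. cis (2 * pi * real k / real N)) {..<N}"
    using Complex.bij_betw_roots_unity[of N] assms by (auto simp: bij_betw_def)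
  from inj_onD[OF this, of k 0] assms have "?w ^ k \<noteq> 1" by (auto simp: eq)
  moreover have "?w ^ N = 1"
    using assms by (simp add: Complex.DeMoivre)
  then have "(?w ^ k) ^ N = 1"
    by (metis mult.commute power_mult power_one)
  ultimately show ?thesis
    using geometric_sum[of "?w ^ k" N] by (simp add: power_mult[symmetric] mult.commute)
qed

section \<open>The resolvent on the closed unit disc and its means over roots of unity\<close>

locale resolvent =
  fixes y :: "'a::continuous_inverse_algebra"
  assumes y: "resolvent_disc 1 y"
begin

definition F :: "complex \<Rightarrow> 'a"
  where "F c = algebra_inv (1 - c *\<^sub>C y)"

text \<open>The exact second-order Taylor remainder of \<open>F\<close> at \<open>a\<close>, divided
  by \<open>(b - a)^2\<close>; it comes from applying the resolvent equation twice. Being continuous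
  on a compact bidisc, it is bounded in every continuous seminorm.\<close>

definition E :: "complex \<Rightarrow> complex \<Rightarrow> 'a"
  where "E a b = y * F a * (y * F a * F b)"

definition zeta :: "nat \<Rightarrow> complex"
  where "zeta N = cis (2 * pi / N)"

text \<open>A Riemann sum for the mean of the resolvent over the circle of radius \<open>r\<close>.
  For \<open>N > 0\<close> it is 1 at \<open>r = 0\<close> and the inverse of
  \<open>1 - y ^ N\<close> at \<open>r = 1\<close>.\<close>

definition G :: "nat \<Rightarrow> real \<Rightarrow> 'a"
  where "G N r = of_real (1 / N) *\<^sub>C (\<Sum>j<N. F (r * zeta N ^ j))"

lemma F: "norm c \<le> 1 \<Longrightarrow> (1 - c *\<^sub>C y) * F c = 1" "norm c \<le> 1 \<Longrightarrow> F c * (1 - c *\<^sub>C y) = 1"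
  using algebra_inv[OF resolvent_discD[OF y]] by (auto simp: F_def)

lemma F_commute: "norm c \<le> 1 \<Longrightarrow> F c * y = y * F c"
  unfolding F_def by (rule algebra_inv_commute[OF resolvent_discD[OF y]]) (auto simp: algebra_simps)

lemma continuous_on_F: "continuous_on (cball 0 1) F"
  unfolding F_def
  by (rule continuous_on_compose2[OF continuous_on_algebra_inv])
    (use y in \<open>auto simp: resolvent_disc_def intro!: continuous_intros\<close>)

lemma F_diff:
  assumes "norm a \<le> 1" "norm b \<le> 1"
  shows "F b - F a = (b - a) *\<^sub>C (y * F a * F b)"
proof -
  have "F b - F a = F a * (1 - a *\<^sub>C y) * F b - F a * ((1 - b *\<^sub>C y) * F b)"
    using assms by (simp add: F)
  also have "\<dots> = F a * ((1 - a *\<^sub>C y) - (1 - b *\<^sub>C y)) * F b"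
    by (simp only: left_diff_distrib right_diff_distrib mult.assoc)
  also have "(1 - a *\<^sub>C y) - (1 - b *\<^sub>C y) = (b - a) *\<^sub>C y"
    by (simp add: scaleC_diff_left)
  finally show ?thesis using F_commute assms by simp
qed

lemma F_taylor:
  assumes "norm a \<le> 1" "norm b \<le> 1"
  shows "F b - F a - (b - a) *\<^sub>C (y * F a * F a) = (b - a)\<^sup>2 *\<^sub>C E a b"
proof -
  have "F b - F a - (b - a) *\<^sub>C (y * F a * F a) =
      (b - a) *\<^sub>C (y * F a * F b) - (b - a) *\<^sub>C (y * F a * F a)"
    by (simp only: F_diff[OF assms])
  also have "\<dots> = (b - a) *\<^sub>C (y * F a * (F b - F a))"
    by (simp only: right_diff_distrib scaleC_diff_right)
  finally show ?thesis
    by (simp add: F_diff[OF assms] E_def power2_eq_square)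
qed

lemma norm_zeta [simp]: "norm (zeta N) = 1"
  by (simp add: zeta_def)

lemma norm_point [simp]: "norm (of_real r * zeta N ^ j) = \<bar>r\<bar>"
  by (simp add: norm_mult norm_power)

lemma zeta_power: "N > 0 \<Longrightarrow> zeta N ^ N = 1"
  unfolding zeta_def Complex.DeMoivre by simp

text \<open>If \<open>c ^ N = 1\<close>, then \<open>1 - y ^ N = 1 - (c y) ^ N\<close>, so
  \<open>F c * (1 - y ^ N)\<close> is a finite geometric sum in \<open>c y\<close>. Averaging over
  the roots of unity kills every power except the constant term.\<close>

lemma G_inverse:
  assumes "N > 0"
  shows "G N 1 * (1 - y ^ N) = 1" "(1 - y ^ N) * G N 1 = 1"
proof -
  have comm: "F c * (1 - y ^ N) = (1 - y ^ N) * F c" if "norm c \<le> 1" for c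
    using power_commuting_commutes[of y "F c" N] F_commute[OF that]
    by (simp add: algebra_simps)
  have F_eq: "F c * (1 - y ^ N) = (\<Sum>k<N. c ^ k *\<^sub>C y ^ k)" if "norm c \<le> 1" "c ^ N = 1" for c
  proof -
    have "1 - y ^ N = (1 - c *\<^sub>C y) * (\<Sum>k<N. (c *\<^sub>C y) ^ k)"
      using that power_telescope(1)[of "c *\<^sub>C y" N] by (simp add: power_scaleC)
    then have "F c * (1 - y ^ N) = (F c * (1 - c *\<^sub>C y)) * (\<Sum>k<N. (c *\<^sub>C y) ^ k)"
      by (simp add: mult.assoc)
    then show ?thesis using that by (simp add: F power_scaleC)
  qed
  have zeta: "(zeta N ^ j) ^ N = 1" for j
    by (metis assms mult.commute power_mult power_one zeta_power)
  have "(\<Sum>j<N. F (zeta N ^ j)) * (1 - y ^ N) = (\<Sum>j<N. F (zeta N ^ j) * (1 - y ^ N))"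
    by (rule sum_distrib_right)
  also have "\<dots> = (\<Sum>j<N. \<Sum>k<N. (zeta N ^ j) ^ k *\<^sub>C y ^ k)"
    using zeta by (intro sum.cong refl F_eq) (auto simp: norm_power)
  also have "\<dots> = (\<Sum>k<N. (\<Sum>j<N. (zeta N ^ j) ^ k) *\<^sub>C y ^ k)"
    by (subst sum.swap) (simp add: scaleC_sum_left)
  also have "\<dots> = (\<Sum>k<N. if k = 0 then of_nat N *\<^sub>C 1 else 0)"
    by (intro sum.cong refl) (auto simp: zeta_def sum_powers_root_of_unity)
  also have "\<dots> = of_nat N *\<^sub>C 1"
    using assms by (simp add: sum.delta)
  finally show 1: "G N 1 * (1 - y ^ N) = 1"
    using assms by (simp add: G_def)
  have "(\<Sum>j<N. F (zeta N ^ j)) * (1 - y ^ N) = (1 - y ^ N) * (\<Sum>j<N. F (zeta N ^ j))"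
    unfolding sum_distrib_right sum_distrib_left by (intro sum.cong refl comm) (auto simp: norm_power)
  then have "G N 1 * (1 - y ^ N) = (1 - y ^ N) * G N 1"
    by (simp add: G_def)
  with 1 show "(1 - y ^ N) * G N 1 = 1" by simp
qed

text \<open>Summing the Taylor expansions of the resolvent between neighbouring points of a circle
  telescopes, which makes the mean of the angular derivatives small; the radial derivative is
  proportional to it.\<close>

lemma G_step:
  assumes p: "continuous_seminorm p"
    and M: "\<And>a b. norm a \<le> 1 \<Longrightarrow> norm b \<le> 1 \<Longrightarrow> p (E a b) \<le> M"
    and r: "0 \<le> s" "s < r" "r \<le> 1" and N: "N > 1"
  shows "p (G N s - G N r) \<le> (r - s) * (M * norm (zeta N - 1)) + M * (r - s)\<^sup>2"
proof -
  interpret cont_seminorm p by unfold_locales (rule p)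
  define w where "w = zeta N"
  define D where "D a = y * F a * F a" for a
  have "M \<ge> 0" using order_trans[OF nonneg M[of 0 0]] by simp
  have pE: "p (c *\<^sub>C E a b) \<le> norm c * M" if "norm a \<le> 1" "norm b \<le> 1" for a b c
    using M[OF that] by (simp add: scale mult_left_mono)
  have "w \<noteq> 1"
  proof
    assume "w = 1"
    then have "(\<Sum>j<N. (zeta N ^ j) ^ 1) = of_nat N" by (simp add: w_def)
    with sum_powers_root_of_unity[of 1 N] N show False by (simp add: zeta_def)
  qed
  have norm_w: "norm (r * w ^ j) = r" "norm (s * w ^ j) = s" for j
    using r by (auto simp: w_def)
  define A where "A = (\<Sum>j<N. w ^ j *\<^sub>C D (r * w ^ j))"
  have taylor_ang: "F (r * w ^ Suc j) - F (r * w ^ j) - (r * (w - 1)) *\<^sub>C w ^ j *\<^sub>C D (r * w ^ j) =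
      (r * (w - 1) * w ^ j)\<^sup>2 *\<^sub>C E (r * w ^ j) (r * w ^ Suc j)" for j
    using F_taylor[of "r * w ^ j" "r * w ^ Suc j"] r norm_w[of j] norm_w[of "Suc j"]
    by (simp add: D_def algebra_simps del: norm_point)
  have "(\<Sum>j<N. F (r * w ^ Suc j) - F (r * w ^ j)) = 0"
    using N by (subst sum_lessThan_telescope) (simp add: w_def zeta_power)
  then have "(r * (w - 1)) *\<^sub>C A =
      - (\<Sum>j<N. (r * (w - 1) * w ^ j)\<^sup>2 *\<^sub>C E (r * w ^ j) (r * w ^ Suc j))"
    unfolding taylor_ang[symmetric] sum_subtractf A_def scaleC_sum_right by simp
  then have "p ((r * (w - 1)) *\<^sub>C A) =
      p (\<Sum>j<N. (r * (w - 1) * w ^ j)\<^sup>2 *\<^sub>C E (r * w ^ j) (r * w ^ Suc j))" by simp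
  also have "\<dots> \<le> (\<Sum>j<N. norm ((r * (w - 1) * w ^ j)\<^sup>2) * M)"
    using r norm_w by (intro order_trans[OF sum sum_mono] pE) (simp_all del: power_Suc)
  also have "\<dots> = (r * norm (w - 1)) * (N * (r * norm (w - 1) * M))"
    using r by (simp add: norm_mult norm_power w_def power2_eq_square)
  finally have "(r * norm (w - 1)) * p A \<le> (r * norm (w - 1)) * (N * (r * norm (w - 1) * M))"
    using r by (simp add: scale norm_mult)
  \<comment> \<open>The remainders carry \<open>norm (w - 1)\<close> squared but \<open>A\<close>
    carries it only once, so cancelling leaves one small factor. Since \<open>N > 1\<close>, the
    root \<open>w\<close> is not 1.\<close>
  moreover have "r * norm (w - 1) > 0" using r \<open>w \<noteq> 1\<close> by simp
  ultimately have "p A \<le> N * (r * norm (w - 1) * M)"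
    by (simp only: mult_le_cancel_left_pos)
  also have "\<dots> \<le> N * (1 * norm (w - 1) * M)"
    using r \<open>M \<ge> 0\<close> by (intro mult_left_mono mult_right_mono) auto
  finally have pA: "p A \<le> N * (norm (w - 1) * M)" by simp
  have taylor_rad: "F (s * w ^ j) - F (r * w ^ j) =
      of_real (s - r) *\<^sub>C w ^ j *\<^sub>C D (r * w ^ j) + (of_real (s - r) * w ^ j)\<^sup>2 *\<^sub>C E (r * w ^ j) (s * w ^ j)" for j
    using F_taylor[of "r * w ^ j" "s * w ^ j"] r norm_w[of j]
    by (simp add: D_def algebra_simps del: norm_point)
  have "G N s - G N r = of_real (1 / N) *\<^sub>C (\<Sum>j<N. F (s * w ^ j) - F (r * w ^ j))"
    by (simp only: G_def w_def sum_subtractf scaleC_diff_right)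
  also have "\<dots> = of_real (1 / N) *\<^sub>C (of_real (s - r) *\<^sub>C A +
      (\<Sum>j<N. (of_real (s - r) * w ^ j)\<^sup>2 *\<^sub>C E (r * w ^ j) (s * w ^ j)))"
    by (simp only: taylor_rad sum.distrib A_def scaleC_sum_right)
  finally have "p (G N s - G N r) = 1 / N * p (of_real (s - r) *\<^sub>C A +
      (\<Sum>j<N. (of_real (s - r) * w ^ j)\<^sup>2 *\<^sub>C E (r * w ^ j) (s * w ^ j)))"
    by (simp only: scale norm_of_real) simp
  also have "\<dots> \<le> 1 / N * ((r - s) * p A + (\<Sum>j<N. norm ((of_real (s - r) * w ^ j)\<^sup>2) * M))"
  proof (rule mult_left_mono[OF order_trans[OF add add_mono]])
    show "p (of_real (s - r) *\<^sub>C A) \<le> (r - s) * p A"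
      using r by (simp only: scale norm_of_real) simp
    show "p (\<Sum>j<N. (of_real (s - r) * w ^ j)\<^sup>2 *\<^sub>C E (r * w ^ j) (s * w ^ j)) \<le>
        (\<Sum>j<N. norm ((of_real (s - r) * w ^ j)\<^sup>2) * M)"
      using r norm_w by (intro order_trans[OF sum sum_mono] pE) simp_all
  qed simp
  also have "(\<Sum>j<N. norm ((of_real (s - r) * w ^ j)\<^sup>2) * M) = N * (M * (r - s)\<^sup>2)"
    by (simp add: norm_mult norm_power w_def power2_commute[of s r] del: of_real_diff)
  also have "1 / N * ((r - s) * p A + N * (M * (r - s)\<^sup>2)) \<le>
      1 / N * ((r - s) * (N * (norm (w - 1) * M)) + N * (M * (r - s)\<^sup>2))"
    using pA r by (intro mult_left_mono add_mono order_refl) auto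
  also have "\<dots> = (r - s) * (M * norm (zeta N - 1)) + M * (r - s)\<^sup>2"
    using N by (simp add: w_def distrib_left mult.commute mult.left_commute)
  finally show ?thesis .
qed

text \<open>The radius runs from 0 to 1 in \<open>N\<close> steps of length \<open>1 / N\<close>.
  The linear errors add up to \<open>M * norm (zeta N - 1)\<close> and the quadratic ones to
  \<open>N\<close> times \<open>M / N^2\<close>; using as many steps as points on the circle makes
  both vanish in the limit.\<close>

lemma G_bound:
  assumes p: "continuous_seminorm p"
    and M: "\<And>a b. norm a \<le> 1 \<Longrightarrow> norm b \<le> 1 \<Longrightarrow> p (E a b) \<le> M" and N: "N > 1"
  shows "p (G N 1 - 1) \<le> M * norm (zeta N - 1) + M / N"
proof -
  interpret cont_seminorm p by unfold_locales (rule p)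
  have "p (G N (real 0 / N) - G N (real i / N)) \<le> i * (1 / N * (M * norm (zeta N - 1)) + M * (1 / N)\<^sup>2)"
    if "i \<le> N" for i
    using that
  proof (induction i)
    case (Suc i)
    have "p (G N (real 0 / N) - G N (real (Suc i) / N)) \<le>
        p (G N (real 0 / N) - G N (real i / N)) + p (G N (real i / N) - G N (real (Suc i) / N))"
      using add[of "G N (real 0 / N) - G N (real i / N)" "G N (real i / N) - G N (real (Suc i) / N)"]
      by simp
    also have "\<dots> \<le> i * (1 / N * (M * norm (zeta N - 1)) + M * (1 / N)\<^sup>2) +
        (1 / N * (M * norm (zeta N - 1)) + M * (1 / N)\<^sup>2)"
    proof (intro add_mono)
      have "p (G N (real i / N) - G N (real (Suc i) / N)) \<le>
        (real (Suc i) / N - real i / N) * (M * norm (zeta N - 1)) + M * (real (Suc i) / N - real i / N)\<^sup>2"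
        using Suc.prems N by (intro G_step[OF p M]) (auto simp: divide_strict_right_mono)
      also have "real (Suc i) / N - real i / N = 1 / N"
        by (simp add: diff_divide_distrib[symmetric])
      finally show "p (G N (real i / N) - G N (real (Suc i) / N)) \<le>
        1 / N * (M * norm (zeta N - 1)) + M * (1 / N)\<^sup>2" .
    qed (use Suc in simp)
    finally show ?case by (simp only: of_nat_Suc distrib_right mult_1 add.commute)
  qed simp
  from this[of N] have "p (G N 0 - G N 1) \<le> N * (1 / N * (M * norm (zeta N - 1)) + M * (1 / N)\<^sup>2)"
    using N by simp
  also have "\<dots> = M * norm (zeta N - 1) + M / N"
    using N by (simp add: distrib_left power2_eq_square)
  also have "G N 0 = 1"
  proof -
    have "F 0 = 1" unfolding F_def by (rule algebra_inv_eqI) auto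
    moreover have "(\<Sum>j<N. 1) = of_nat N *\<^sub>C (1::'a)"
      by (induction N) (auto simp: scaleC_add_left)
    ultimately show ?thesis using N by (simp add: G_def)
  qed
  finally show ?thesis by (simp add: minus_commute)
qed

lemma G_tendsto: "(\<lambda>N. G N 1) \<longlonglongrightarrow> 1"
proof (rule tendsto_seminormI)
  fix p :: "'a \<Rightarrow> real" assume p: "continuous_seminorm p"
  interpret cont_seminorm p by unfold_locales (rule p)
  have "\<exists>M>0. \<forall>z\<in>cball 0 1 \<times> cball 0 1. p (E (fst z) (snd z)) \<le> M"
    unfolding E_def
    by (intro bounded_on_compact compact_Times compact_cball continuous_intros
        continuous_on_compose2[OF continuous_on_F]) auto
  then obtain M where "\<And>z. z \<in> cball 0 1 \<times> cball 0 1 \<Longrightarrow> p (E (fst z) (snd z)) \<le> M" by blast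
  then have M: "p (E a b) \<le> M" if "norm a \<le> 1" "norm b \<le> 1" for a b
    using that by (metis fst_conv snd_conv mem_Sigma_iff mem_cball_0)
  have "(\<lambda>N. 2 * pi / real N) \<longlonglongrightarrow> 0"
    by (intro tendsto_divide_0[OF tendsto_const] filterlim_real_at_infinity_sequentially)
  then have "(\<lambda>N. zeta N) \<longlonglongrightarrow> cis 0"
    unfolding zeta_def by (rule tendsto_cis)
  then have "(\<lambda>N. M * norm (zeta N - 1) + M / N) \<longlonglongrightarrow> M * norm (cis 0 - 1) + 0"
    by (intro tendsto_intros tendsto_divide_0[OF tendsto_const] filterlim_real_at_infinity_sequentially)
  then have lim: "(\<lambda>N. M * norm (zeta N - 1) + M / N) \<longlonglongrightarrow> 0" by simp
  show "(\<lambda>N. p (G N 1 - 1)) \<longlonglongrightarrow> 0"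
  proof (rule tendsto_sandwich[OF _ _ tendsto_const lim])
    show "\<forall>\<^sub>F N in sequentially. p (G N 1 - 1) \<le> M * norm (zeta N - 1) + M / N"
      using eventually_gt_at_top[of 1] by eventually_elim (rule G_bound[OF p M])
  qed simp
qed

text \<open>\<open>y ^ N\<close> is 1 minus the inverse of \<open>G N 1\<close>; as
  \<open>G N 1\<close> tends to 1, continuity of the inversion at 1 suffices.\<close>

lemma power_tendsto_zero: "(\<lambda>n. y ^ n) \<longlonglongrightarrow> 0"
proof -
  have "(\<lambda>N. 1 - algebra_inv (G N 1)) \<longlonglongrightarrow> 1 - algebra_inv 1"
    by (intro tendsto_intros tendsto_algebra_inv_compose G_tendsto) simp
  also have "algebra_inv 1 = (1::'a)" by (rule algebra_inv_eqI) auto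
  finally have "(\<lambda>N. 1 - algebra_inv (G N 1)) \<longlonglongrightarrow> 0" by simp
  moreover have "\<forall>\<^sub>F N in sequentially. 1 - algebra_inv (G N 1) = y ^ N"
    using eventually_gt_at_top[of 0] by eventually_elim (simp add: algebra_inv_eqI[OF G_inverse])
  ultimately show ?thesis by (rule Lim_transform_eventually)
qed

end

lemma power_tendsto_zero:
  fixes x :: "'a::continuous_inverse_algebra"
  assumes "resolvent_disc R x" "R \<ge> 0"
  shows "(\<lambda>n. of_real (R ^ n) *\<^sub>C x ^ n) \<longlonglongrightarrow> 0"
proof -
  interpret resolvent "of_real R *\<^sub>C x"
    by unfold_locales (rule resolvent_disc_scale[OF assms(1)], use assms(2) in simp)
  from power_tendsto_zero show ?thesis by (simp add: power_scaleC)
qed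

lemma resolvent_disc_near_zero:
  "\<exists>p. continuous_seminorm p \<and> (\<forall>x::'a::continuous_inverse_algebra. p x < 1 \<longrightarrow> resolvent_disc 1 x)"
proof -
  have "open ((\<lambda>x. 1 - x) -` (algebra_units::'a set))"
    by (intro open_vimage open_algebra_units continuous_intros)
  from continuous_seminorm_exists[OF this]
  obtain p where p: "continuous_seminorm p" "\<And>x::'a. p x < 1 \<Longrightarrow> 1 - x \<in> algebra_units" by auto
  interpret cont_seminorm p by unfold_locales (rule p)
  have "resolvent_disc 1 x" if "p x < 1" for x
    unfolding resolvent_disc_def
  proof safe
    fix c :: complex assume "norm c \<le> 1"
    then have "p (c *\<^sub>C x) \<le> 1 * p x" unfolding scale by (intro mult_right_mono) auto
    with that show "1 - c *\<^sub>C x \<in> algebra_units" by (intro p(2)) simp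
  qed
  with p(1) show ?thesis by blast
qed

section \<open>The binomial series for the square root\<close>

text \<open>The Taylor coefficients of the square root of \<open>1 - x\<close> at 0.\<close>

definition sqrt_coeff :: "nat \<Rightarrow> real"
  where "sqrt_coeff k = (- 1) ^ k * ((1 / 2) gchoose k)"

lemma sqrt_coeff_bound: "\<bar>sqrt_coeff k\<bar> \<le> 1"
proof (induction k)
  case (Suc k)
  have "sqrt_coeff (Suc k) = sqrt_coeff k * ((real k - 1 / 2) / (real k + 1))"
    by (simp add: sqrt_coeff_def gbinomial_prod_rev field_simps)
  moreover have "\<bar>(real k - 1 / 2) / (real k + 1)\<bar> \<le> 1"
    by (auto simp: abs_if field_simps)
  ultimately show ?case
    using Suc mult_mono[OF Suc] by (simp add: abs_mult mult_le_one)
qed (simp add: sqrt_coeff_def)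

text \<open>Vandermonde's identity turns the convolution into the binomial coefficients of exponent
  \<open>1 / 2 + 1 / 2 = 1\<close>, that is, into the coefficients of \<open>1 - x\<close>.\<close>

lemma sqrt_coeff_convolution:
  "(\<Sum>i\<le>k. sqrt_coeff i * sqrt_coeff (k - i)) = (if k = 0 then 1 else if k = 1 then - 1 else 0)"
proof -
  have "(\<Sum>i\<le>k. sqrt_coeff i * sqrt_coeff (k - i)) =
      (\<Sum>i\<le>k. (- 1) ^ k * (((1 / 2) gchoose i) * ((1 / 2) gchoose (k - i))))"
    by (intro sum.cong refl) (auto simp: sqrt_coeff_def simp flip: power_add)
  also have "\<dots> = (- 1) ^ k * ((1 / 2 + 1 / 2) gchoose k)"
    by (simp only: gbinomial_Vandermonde[symmetric] sum_distrib_left atMost_atLeast0)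
  also have "((1 / 2 + 1 / 2 :: real) gchoose k) = of_nat (1 choose k)"
    by (simp add: binomial_gbinomial)
  finally show ?thesis by (auto simp: binomial_eq_0)
qed

text \<open>The constant \<open>K\<close> may depend on the seminorm, but the rate \<open>q\<close>
  may not: dividing the differences by the common scale \<open>q ^ min m n\<close> leaves a bounded
  set, which is what a Mackey-Cauchy sequence requires.\<close>

lemma Mackey_CauchyI_geometric:
  fixes s :: "nat \<Rightarrow> 'a::locally_convex_space"
  assumes q: "0 < q" "q < 1"
    and s: "\<And>p. continuous_seminorm p \<Longrightarrow> \<exists>K. \<forall>m n. n \<le> m \<longrightarrow> p (s m - s n) \<le> K * q ^ n"
  shows "Mackey_Cauchy s"
proof -
  define B where "B = (\<lambda>(m, n). of_real (1 / q ^ min m n) *\<^sub>C (s m - s n)) ` UNIV"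
  define t where "t = (\<lambda>(m, n). q ^ min m n :: real)"
  have "von_neumann_bounded B"
  proof (rule von_neumann_boundedI)
    fix p :: "'a \<Rightarrow> real" assume p: "continuous_seminorm p"
    interpret cont_seminorm p by unfold_locales (rule p)
    obtain K where K: "\<And>m n. n \<le> m \<Longrightarrow> p (s m - s n) \<le> K * q ^ n" using s[OF p] by blast
    have "p (s m - s n) \<le> K * q ^ min m n" for m n
      using K[of n m] K[of m n] minus_commute[of "s m" "s n"] by (cases "n \<le> m") auto
    then have "p (of_real (1 / q ^ min m n) *\<^sub>C (s m - s n)) \<le> K" for m n
      using q by (simp only: scale norm_of_real) (simp add: field_simps)
    then show "\<exists>M. \<forall>b\<in>B. p b \<le> M" by (auto simp: B_def)
  qed
  moreover have "(t \<longlongrightarrow> 0) (sequentially \<times>\<^sub>F sequentially)"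
  proof (rule tendsto_sandwich[OF _ _ tendsto_const])
    have lim: "(\<lambda>n. q ^ n) \<longlonglongrightarrow> 0" using q by (intro LIMSEQ_realpow_zero) auto
    have "((\<lambda>z. q ^ fst z + q ^ snd z) \<longlongrightarrow> 0 + 0) (sequentially \<times>\<^sub>F sequentially)"
      by (intro tendsto_add filterlim_compose[OF lim] filterlim_fst filterlim_snd)
    then show "((\<lambda>z. q ^ fst z + q ^ snd z) \<longlongrightarrow> 0) (sequentially \<times>\<^sub>F sequentially)" by simp
    show "\<forall>\<^sub>F z in sequentially \<times>\<^sub>F sequentially. t z \<le> q ^ fst z + q ^ snd z"
      using q by (intro always_eventually) (auto simp: t_def min_def)
    show "\<forall>\<^sub>F z in sequentially \<times>\<^sub>F sequentially. 0 \<le> t z"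
      using q by (intro always_eventually) (auto simp: t_def)
  qed
  moreover have "s m - s n \<in> (\<lambda>b. t (m, n) *\<^sub>R b) ` B" for m n
  proof
    show "s m - s n = t (m, n) *\<^sub>R (of_real (1 / q ^ min m n) *\<^sub>C (s m - s n))"
      using q by (simp add: t_def scaleR_scaleC)
    show "of_real (1 / q ^ min m n) *\<^sub>C (s m - s n) \<in> B"
      unfolding B_def by (rule image_eqI[of _ _ "(m, n)"]) auto
  qed
  ultimately show ?thesis unfolding Mackey_Cauchy_def by blast
qed

text \<open>The rescaled powers converge and so are bounded in each seminorm. Only \<open>K\<close>
  depends on \<open>p\<close>, not the rate \<open>1 / S\<close>.\<close>

lemma power_seminorm_bound:
  fixes x :: "'a::continuous_inverse_algebra"
  assumes x: "resolvent_disc S x" "S > 0" and p: "continuous_seminorm p"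
  shows "\<exists>K\<ge>0. \<forall>n. p (x ^ n) \<le> K * (1 / S) ^ n"
proof -
  interpret cont_seminorm p by unfold_locales (rule p)
  have "(\<lambda>n. p (of_real (S ^ n) *\<^sub>C x ^ n)) \<longlonglongrightarrow> p 0"
    using x by (intro tendsto power_tendsto_zero) auto
  then have "Bseq (\<lambda>n. p (of_real (S ^ n) *\<^sub>C x ^ n))"
    by (intro convergent_imp_Bseq convergentI)
  then obtain K where K: "K > 0" "\<And>n. norm (p (of_real (S ^ n) *\<^sub>C x ^ n)) \<le> K"
    unfolding Bseq_def by blast
  have "p (x ^ n) \<le> K * (1 / S) ^ n" for n
  proof -
    have "S ^ n * p (x ^ n) \<le> K"
      using K(2)[of n] x(2) by (simp only: scale norm_of_real) simp
    then show ?thesis using x(2) by (simp add: field_simps)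
  qed
  with K(1) show ?thesis by (intro exI[of _ K]) auto
qed

definition sqrt_sum :: "'a::{complex_algebra, monoid_mult} \<Rightarrow> nat \<Rightarrow> 'a"
  where "sqrt_sum x n = (\<Sum>k<n. of_real (sqrt_coeff k) *\<^sub>C x ^ k)"

text \<open>The pairs with \<open>i + j < n\<close> form complete convolutions and contribute
  exactly \<open>1 - x\<close>; \<open>n \<ge> 2\<close> ensures that both nonzero coefficients
  occur among them. The other pairs are the error, which involves only powers of \<open>x\<close> of
  exponent at least \<open>n\<close>.\<close>

lemma sqrt_sum_square:
  fixes x :: "'a::{complex_algebra, monoid_mult}"
  assumes "n \<ge> 2"
  shows "sqrt_sum x n * sqrt_sum x n = 1 - x +
    (\<Sum>(i, j)\<in>{(i, j). i < n \<and> j < n \<and> n \<le> i + j}.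
      of_real (sqrt_coeff i * sqrt_coeff j) *\<^sub>C x ^ (i + j))"
proof -
  let ?f = "\<lambda>i j. of_real (sqrt_coeff i * sqrt_coeff j) *\<^sub>C x ^ (i + j)"
  define A B where "A = {(i, j). i + j < n}" and "B = {(i, j). i < n \<and> j < n \<and> n \<le> i + j}"
  have un: "{..<n} \<times> {..<n} = A \<union> B" by (auto simp: A_def B_def)
  have "finite (A \<union> B)" unfolding un[symmetric] by simp
  then have finAB: "finite A" "finite B" by auto
  have "(of_real a *\<^sub>C x ^ i) * (of_real b *\<^sub>C x ^ j) = of_real (a * b) *\<^sub>C x ^ (i + j)" for a b i j
    by (simp add: power_add mult.commute)
  then have "sqrt_sum x n * sqrt_sum x n = (\<Sum>i<n. \<Sum>j<n. ?f i j)"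
    by (simp only: sqrt_sum_def sum_product)
  also have "\<dots> = (\<Sum>(i, j)\<in>A \<union> B. ?f i j)"
    unfolding un[symmetric] by (rule sum.cartesian_product)
  also have "\<dots> = (\<Sum>(i, j)\<in>A. ?f i j) + (\<Sum>(i, j)\<in>B. ?f i j)"
    by (intro sum.union_disjoint finAB) (auto simp: A_def B_def)
  also have "(\<Sum>(i, j)\<in>A. ?f i j) = (\<Sum>k<n. \<Sum>i\<le>k. ?f i (k - i))"
    unfolding A_def by (rule sum.triangle_reindex)
  also have "\<dots> = (\<Sum>k<n. of_real (\<Sum>i\<le>k. sqrt_coeff i * sqrt_coeff (k - i)) *\<^sub>C x ^ k)"
    by (simp add: scaleC_sum_left)
  also have "\<dots> = (\<Sum>k<n. of_real (if k = 0 then 1 else if k = 1 then - 1 else 0) *\<^sub>C x ^ k)"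
    by (simp only: sqrt_coeff_convolution)
  also have "\<dots> = 1 - x"
  proof -
    obtain m where m: "n = Suc (Suc m)" using assms by (metis add_2_eq_Suc le_Suc_ex)
    show ?thesis
      unfolding m sum.lessThan_Suc_shift by (simp add: scaleC_minus_left)
  qed
  finally show ?thesis by (simp add: B_def)
qed

lemma sqrt_sum_square_tendsto:
  fixes x :: "'a::continuous_inverse_algebra"
  assumes x: "resolvent_disc S x" "S > 1"
  shows "(\<lambda>n. sqrt_sum x n * sqrt_sum x n) \<longlonglongrightarrow> 1 - x"
proof (rule tendsto_seminormI)
  fix p :: "'a \<Rightarrow> real" assume p: "continuous_seminorm p"
  interpret cont_seminorm p by unfold_locales (rule p)
  define q where "q = 1 / S"
  have q: "0 < q" "q < 1" using x(2) by (auto simp: q_def)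
  obtain K where K: "K \<ge> 0" "\<And>n. p (x ^ n) \<le> K * q ^ n"
    using power_seminorm_bound[OF x(1) _ p] x(2) by (auto simp: q_def)
  \<comment> \<open>The error has at most \<open>n^2\<close> terms of size \<open>K q^n\<close>.
    Writing \<open>n^2 q^n\<close> as a square reduces its limit to that of \<open>n * r ^ n\<close>
    with \<open>r = sqrt q\<close>.\<close>
  have bound: "p (sqrt_sum x n * sqrt_sum x n - (1 - x)) \<le> (real n * sqrt q ^ n)\<^sup>2 * K" if "n \<ge> 2" for n
  proof -
    let ?B = "{(i, j). i < n \<and> j < n \<and> n \<le> i + j}"
    have sub: "?B \<subseteq> {..<n} \<times> {..<n}" by auto
    have "p (sqrt_sum x n * sqrt_sum x n - (1 - x)) =
        p (\<Sum>(i, j)\<in>?B. of_real (sqrt_coeff i * sqrt_coeff j) *\<^sub>C x ^ (i + j))"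
      by (simp only: sqrt_sum_square[OF that]) simp
    also have "\<dots> \<le> (\<Sum>z\<in>?B. K * q ^ n)"
    proof (rule order_trans[OF sum sum_mono])
      fix z assume "z \<in> ?B"
      then obtain i j where z: "z = (i, j)" "n \<le> i + j" by auto
      have "p (of_real (sqrt_coeff i * sqrt_coeff j) *\<^sub>C x ^ (i + j)) =
          \<bar>sqrt_coeff i\<bar> * \<bar>sqrt_coeff j\<bar> * p (x ^ (i + j))"
        by (simp only: scale norm_of_real abs_mult)
      also have "\<dots> \<le> 1 * p (x ^ (i + j))"
        using sqrt_coeff_bound by (intro mult_right_mono mult_le_one) auto
      also have "\<dots> \<le> K * q ^ (i + j)" using K(2) by simp
      also have "\<dots> \<le> K * q ^ n"
        using z(2) q K(1) by (intro mult_left_mono power_decreasing) auto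
      finally show "p (case z of (i, j) \<Rightarrow> of_real (sqrt_coeff i * sqrt_coeff j) *\<^sub>C x ^ (i + j)) \<le> K * q ^ n"
        by (simp add: z)
    qed
    also have "\<dots> = card ?B * (K * q ^ n)" by simp
    also have "\<dots> \<le> real (n * n) * (K * q ^ n)"
      using card_mono[OF _ sub] q K(1) by (intro mult_right_mono) (auto simp flip: of_nat_mult)
    also have "\<dots> = (real n * sqrt q ^ n)\<^sup>2 * K"
    proof -
      have "(sqrt q ^ n)\<^sup>2 = q ^ n"
        using q by (metis less_imp_le mult.commute power_mult real_sqrt_pow2)
      then show ?thesis by (simp add: power_mult_distrib power2_eq_square[of "real n"])
    qed
    finally show ?thesis .
  qed
  have "(\<lambda>n. real n * sqrt q ^ n) \<longlonglongrightarrow> 0"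
    using q powser_times_n_limit_0[of "sqrt q"] by simp
  then have "(\<lambda>n. (real n * sqrt q ^ n)\<^sup>2 * K) \<longlonglongrightarrow> 0\<^sup>2 * K"
    by (intro tendsto_intros)
  then have lim: "(\<lambda>n. (real n * sqrt q ^ n)\<^sup>2 * K) \<longlonglongrightarrow> 0" by simp
  show "(\<lambda>n. p (sqrt_sum x n * sqrt_sum x n - (1 - x))) \<longlonglongrightarrow> 0"
  proof (rule tendsto_sandwich[OF _ _ tendsto_const lim])
    show "\<forall>\<^sub>F n in sequentially. p (sqrt_sum x n * sqrt_sum x n - (1 - x)) \<le> (real n * sqrt q ^ n)\<^sup>2 * K"
      using eventually_ge_at_top[of 2] by eventually_elim (rule bound)
  qed simp
qed

text \<open>A strictly larger resolvent disc gives the powers of \<open>x\<close> a common geometric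
  rate, so the partial sums are Mackey-Cauchy. The clause on \<open>z\<close> passes from the
  partial sums to the limit; it serves for the self-adjointness of the root and for its commutation
  with the idempotents of a flag.\<close>

lemma sqrt_one_diff_exists:
  fixes x :: "'a::{continuous_inverse_algebra, Mackey_complete_space}"
  assumes "resolvent_disc 1 x"
  shows "\<exists>b. b * b = 1 - x \<and> (\<forall>z. z * x = x * z \<longrightarrow> z * b = b * z)"
proof -
  obtain S where S: "S > 1" "resolvent_disc S x"
    using resolvent_disc_extend[OF assms] by auto
  define q where "q = 1 / S"
  have q: "0 < q" "q < 1" using S by (auto simp: q_def)
  have "Mackey_Cauchy (sqrt_sum x)"
  proof (rule Mackey_CauchyI_geometric[OF q])
    fix p :: "'a \<Rightarrow> real" assume p: "continuous_seminorm p"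
    interpret cont_seminorm p by unfold_locales (rule p)
    obtain K where K: "K \<ge> 0" "\<And>n. p (x ^ n) \<le> K * q ^ n"
      using power_seminorm_bound[OF S(2) _ p] S(1) by (auto simp: q_def)
    have "p (sqrt_sum x m - sqrt_sum x n) \<le> K / (1 - q) * q ^ n" if "n \<le> m" for m n
    proof -
      \<comment> \<open>The bound is \<open>K\<close> times the finite geometric sum from
        \<open>n\<close> to \<open>m - 1\<close>; the subtracted \<open>q ^ m\<close> is the room
        that the induction needs.\<close>
      have "p (sqrt_sum x m - sqrt_sum x n) \<le> K / (1 - q) * (q ^ n - q ^ m)"
        using that
      proof (induction rule: dec_induct)
        case (step m)
        have "p (sqrt_sum x (Suc m) - sqrt_sum x n) =
            p ((sqrt_sum x m - sqrt_sum x n) + of_real (sqrt_coeff m) *\<^sub>C x ^ m)"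
          by (simp add: sqrt_sum_def algebra_simps)
        also have "\<dots> \<le> p (sqrt_sum x m - sqrt_sum x n) + \<bar>sqrt_coeff m\<bar> * p (x ^ m)"
          using add by (metis norm_of_real scale)
        also have "\<dots> \<le> K / (1 - q) * (q ^ n - q ^ m) + 1 * (K * q ^ m)"
          using sqrt_coeff_bound K by (intro add_mono step.IH mult_mono) auto
        also have "\<dots> = K / (1 - q) * (q ^ n - q ^ Suc m)"
          using q by (simp add: field_simps)
        finally show ?case .
      qed simp
      also have "\<dots> \<le> K / (1 - q) * q ^ n"
        using q K(1) by (intro mult_left_mono) auto
      finally show ?thesis .
    qed
    then show "\<exists>K. \<forall>m n. n \<le> m \<longrightarrow> p (sqrt_sum x m - sqrt_sum x n) \<le> K * q ^ n" by blast
  qed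
  then obtain b where b: "sqrt_sum x \<longlonglongrightarrow> b"
    using Mackey_Cauchy_convergent unfolding convergent_def by blast
  have "b * b = 1 - x"
    using LIMSEQ_unique[OF tendsto_mult[OF b b] sqrt_sum_square_tendsto[OF S(2,1)]] .
  moreover have "z * b = b * z" if z: "z * x = x * z" for z
  proof -
    have "z * sqrt_sum x n = sqrt_sum x n * z" for n
      unfolding sqrt_sum_def sum_distrib_left sum_distrib_right
      by (intro sum.cong refl) (use power_commuting_commutes[of x z] z in simp)
    then show ?thesis
      using LIMSEQ_unique[OF tendsto_mult_left[OF b, of z]] tendsto_mult_right[OF b, of z] by simp
  qed
  ultimately show ?thesis by blast
qed

section \<open>Hermitian algebras\<close>

locale hermitian_cia =
  fixes star :: "'a::{continuous_inverse_algebra, Mackey_complete_space} \<Rightarrow> 'a"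
  assumes hermitian: "is_hermitian star"
begin

lemma star_add: "star (a + b) = star a + star b"
  and star_scaleC: "star (c *\<^sub>C a) = cnj c *\<^sub>C star a"
  and star_mult: "star (a * b) = star b * star a"
  and star_star [simp]: "star (star a) = a"
  using hermitian by (auto simp: is_hermitian_def is_involution_def)

lemma star_zero [simp]: "star 0 = 0"
  using star_scaleC[of 0 0] by simp

lemma star_minus: "star (- a) = - star a"
  using star_scaleC[of "-1" a] by (simp add: scaleC_minus_left)

lemma star_diff: "star (a - b) = star a - star b"
  using star_add[of a "-b"] by (simp add: star_minus)

lemma star_one [simp]: "star 1 = 1"
  using star_mult[of "star 1" 1] by simp

lemmas star_simps = star_add star_diff star_minus star_scaleC star_mult

lemma star_power: "star (a ^ n) = star a ^ n"
  by (induction n) (auto simp: star_mult power_commutes)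

lemma star_unit:
  assumes "a \<in> algebra_units"
  shows "star a \<in> algebra_units"
  by (rule algebra_unitI[of _ "star (algebra_inv a)"])
    (simp_all add: algebra_inv[OF assms] flip: star_mult)

lemma star_inv:
  assumes "a \<in> algebra_units"
  shows "star (algebra_inv a) = algebra_inv (star a)"
  by (rule algebra_inv_eqI[symmetric]) (simp_all add: algebra_inv[OF assms] flip: star_mult)

lemma hermitian_resolvent:
  "star h = h \<Longrightarrow> z \<notin> \<real> \<Longrightarrow> z *\<^sub>C 1 - h \<in> algebra_units"
  using hermitian by (auto simp: is_hermitian_def algebra_spectrum_def)

lemma skew_resolvent:
  assumes "star m = - m" "Re z \<noteq> 0"
  shows "z *\<^sub>C 1 - m \<in> algebra_units"
proof -
  have "star (\<i> *\<^sub>C m) = \<i> *\<^sub>C m"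
    using assms by (simp add: star_simps scaleC_minus_left scaleC_minus_right)
  moreover have "\<i> * z \<notin> \<real>" using assms(2) by (simp add: complex_is_Real_iff)
  ultimately have "(\<i> * z) *\<^sub>C 1 - \<i> *\<^sub>C m \<in> algebra_units" by (rule hermitian_resolvent)
  then have "\<i> *\<^sub>C (z *\<^sub>C 1 - m) \<in> algebra_units" by (simp add: scaleC_diff_right)
  then show ?thesis by simp
qed

lemma one_plus_skew_unit:
  assumes "star s = - s"
  shows "1 + s \<in> algebra_units"
  using skew_resolvent[of "- s" 1] assms by (simp add: star_minus)

text \<open>The involution need not be continuous, so it is not clear that the sum of the binomial series
  is self-adjoint. Its skew part \<open>m\<close> annihilates the self-adjoint part, which makes it quasinilpotent,
  while \<open>m / b\<close> is idempotent.\<close>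

lemma sqrt_self_adjoint:
  assumes x: "star x = x" "resolvent_disc 1 x"
    and b: "b * b = 1 - x" and bc: "\<And>z. z * x = x * z \<Longrightarrow> z * b = b * z"
  shows "star b = b"
proof -
  define k m where "k = (1 / 2) *\<^sub>C (b + star b)" and "m = (1 / 2) *\<^sub>C (b - star b)"
  have xb: "x = 1 - b * b" using b by simp
  have "b * x = x * b" unfolding xb by (simp add: algebra_simps)
  then have "star b * x = x * star b" by (metis star_mult x(1))
  then have comm: "star b * b = b * star b" by (rule bc)
  have bb: "star b * star b = b * b" using b x(1) by (simp add: star_diff flip: star_mult)
  have "(b + star b) * (b - star b) = 0" "(b - star b) * (b + star b) = 0"
    by (simp_all add: algebra_simps comm bb)
  then have km: "k * m = 0" "m * k = 0"
    by (simp_all add: k_def m_def)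
  have b_eq: "b = k + m"
  proof -
    have "k + m = (1 / 2) *\<^sub>C ((b + star b) + (b - star b))"
      by (simp only: k_def m_def scaleC_add_right)
    also have "(b + star b) + (b - star b) = 2 *\<^sub>C b"
      using scaleC_add_left[of 1 1 b] by simp
    finally show ?thesis by simp
  qed
  have m_skew: "star m = - m"
    by (simp add: m_def star_simps scaleC_diff_right)
  have "1 - x \<in> algebra_units" using resolvent_discD[OF x(2), of 1] by simp
  then have b_unit: "b \<in> algebra_units" using b unit_commuting_factor by metis
  have imag: "z *\<^sub>C 1 - b \<in> algebra_units" if z: "Re z = 0" for z
  proof -
    \<comment> \<open>On the imaginary axis \<open>z^2 - b^2 = x - t\<close>, and
      \<open>t \<ge> 1\<close> places \<open>1 / t\<close> in the unit disc.\<close>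
    define t where "t = 1 + (Im z)\<^sup>2"
    have t: "t \<ge> 1" by (simp add: t_def)
    have zz: "z * z = - of_real (t - 1)"
      using z by (simp add: complex_eq_iff t_def power2_eq_square)
    have "(z *\<^sub>C 1 - b) * (z *\<^sub>C 1 + b) = (z * z) *\<^sub>C 1 - b * b"
      by (simp add: algebra_simps scaleC_linear)
    also have "\<dots> = - of_real t *\<^sub>C (1 - of_real (1 / t) *\<^sub>C x)"
      using t unfolding b zz by (simp add: scaleC_linear)
    also have "\<dots> \<in> algebra_units"
      using resolvent_discD[OF x(2), of "of_real (1 / t)"] t by (simp add: norm_divide)
    finally show ?thesis by (rule unit_commuting_factor) (simp add: algebra_simps scaleC_linear)
  qed
  have m_units: "1 - c *\<^sub>C m \<in> algebra_units" for c
  proof (cases "c = 0")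
    case False
    define z where "z = 1 / c"
    have "z *\<^sub>C 1 - m \<in> algebra_units"
    \<comment> \<open>Off the imaginary axis the skewness of \<open>m\<close> suffices. On it,
      \<open>k * m = 0\<close> gives \<open>z (z - b) = (z - m) (z - k)\<close>, which transfers
      invertibility from \<open>b\<close> to \<open>m\<close>.\<close>
    proof (cases "Re z = 0")
      case True
      have "z *\<^sub>C (z *\<^sub>C 1 - b) \<in> algebra_units" using imag[OF True] False by (simp add: z_def)
      also have "z *\<^sub>C (z *\<^sub>C 1 - b) = (z *\<^sub>C 1 - m) * (z *\<^sub>C 1 - k)"
        by (simp add: b_eq algebra_simps scaleC_linear km)
      finally show ?thesis
        by (rule unit_commuting_factor) (simp add: algebra_simps scaleC_linear km)
    qed (rule skew_resolvent[OF m_skew])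
    then have "c *\<^sub>C (z *\<^sub>C 1 - m) \<in> algebra_units" using False by simp
    then show ?thesis using False by (simp add: z_def scaleC_diff_right)
  qed simp
  define d where "d = algebra_inv b"
  have bm: "b * m = m * m" "m * b = m * m" by (simp_all add: b_eq algebra_simps km)
  have dm: "m * d = d * m"
    unfolding d_def using algebra_inv_commute[OF b_unit, of m] bm by simp
  have bd: "b * d = 1" "d * b = 1" using algebra_inv[OF b_unit] by (simp_all add: d_def)
  have "(m * d) * (m * d) = (m * m) * (d * d)" using dm by (metis mult.assoc)
  also have "\<dots> = m * d" by (metis bd(1) bm(2) mult.assoc mult_1_left)
  finally have idem: "(m * d) ^ Suc n = m * d" for n
    by (induction n) simp_all
  \<comment> \<open>The powers of \<open>d\<close> may grow like \<open>r^-n\<close>. As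
    \<open>1 - c m\<close> is a unit for every \<open>c\<close>, the powers of \<open>m\<close>
    decay faster than any geometric rate and absorb this growth, so the constant powers of
    \<open>m * d\<close> tend to 0.\<close>
  obtain r where r: "r > 0" "resolvent_disc r d" using resolvent_disc_exists by blast
  have "(\<lambda>n. of_real ((1 / r) ^ n) *\<^sub>C m ^ n) \<longlonglongrightarrow> 0"
    using m_units r by (intro power_tendsto_zero) (auto simp: resolvent_disc_def)
  moreover have "(\<lambda>n. of_real (r ^ n) *\<^sub>C d ^ n) \<longlonglongrightarrow> 0"
    using r by (intro power_tendsto_zero) auto
  ultimately have "(\<lambda>n. (of_real ((1 / r) ^ n) *\<^sub>C m ^ n) * (of_real (r ^ n) *\<^sub>C d ^ n)) \<longlonglongrightarrow> 0 * 0"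
    by (rule tendsto_mult)
  also have "(\<lambda>n. (of_real ((1 / r) ^ n) *\<^sub>C m ^ n) * (of_real (r ^ n) *\<^sub>C d ^ n)) = (\<lambda>n. (m * d) ^ n)"
    using r(1) by (auto simp: power_commuting_mult[OF dm] power_divide)
  finally have "(\<lambda>n. (m * d) ^ n) \<longlonglongrightarrow> 0" by simp
  from LIMSEQ_Suc[OF this] have "m * d = 0" unfolding idem by (simp add: LIMSEQ_const_iff)
  then have "m = 0" by (metis bd(2) mult.assoc mult_1_right mult_zero_left)
  then have "b - star b = 0"
    unfolding m_def by (metis scaleC_one scaleC_scaleC scaleC_zero_right nonzero_eq_divide_eq
        mult.commute zero_neq_numeral)
  then show ?thesis by simp
qed

lemma self_adjoint_sqrt_exists:
  assumes "star x = x" "resolvent_disc 1 x"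
  shows "\<exists>b. b * b = 1 - x \<and> star b = b \<and> (\<forall>z. z * x = x * z \<longrightarrow> z * b = b * z)"
  using sqrt_one_diff_exists[OF assms(2)] sqrt_self_adjoint[OF assms] by metis

text \<open>With a self-adjoint root \<open>w\<close> of \<open>1 - x\<close> and its inverse
  \<open>d\<close>, the element is \<open>w * (1 + d * s * d) * w\<close>, and
  \<open>d * s * d\<close> is again skew.\<close>

lemma one_diff_plus_skew_unit:
  assumes x: "star x = x" "resolvent_disc 1 x" and s: "star s = - s"
  shows "1 - x + s \<in> algebra_units"
proof -
  obtain w where w: "w * w = 1 - x" "star w = w"
    using self_adjoint_sqrt_exists[OF x] by blast
  have "1 - x \<in> algebra_units" using resolvent_discD[OF x(2), of 1] by simp
  then have wu: "w \<in> algebra_units" using w unit_commuting_factor by metis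
  define d where "d = algebra_inv w"
  have d: "w * d = 1" "d * w = 1" using algebra_inv[OF wu] by (simp_all add: d_def)
  have "star d = d" by (simp add: d_def star_inv[OF wu] w)
  then have "1 + d * s * d \<in> algebra_units"
    by (intro one_plus_skew_unit) (simp add: star_mult s mult.assoc)
  then have "w * (1 + d * s * d) * w \<in> algebra_units" by (intro unit_mult wu)
  also have "w * (1 + d * s * d) * w = w * w + (w * d) * s * (d * w)"
    by (simp add: algebra_simps)
  finally show ?thesis by (simp add: d w)
qed

text \<open>This is the inequality \<open>\<rho>(a)\<^sup>2 \<le> \<rho>(a\<^sup>* a)\<close> of Ptak for the spectral radius.\<close>

lemma resolvent_disc_star_mult:
  assumes a: "resolvent_disc 1 (star a * a)"
  shows "resolvent_disc 1 a"
  unfolding resolvent_disc_def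
proof safe
  fix c :: complex assume c: "norm c \<le> 1"
  define b where "b = c *\<^sub>C a"
  have "star b * b = (cnj c * c) *\<^sub>C (star a * a)" by (simp add: b_def star_simps mult.commute)
  moreover have "norm (cnj c * c) * 1 \<le> 1" using c by (simp add: norm_mult mult_le_one)
  ultimately have 1: "resolvent_disc 1 (star b * b)"
    using resolvent_disc_scale[OF a] by metis
  then have 2: "resolvent_disc 1 (b * star b)" by (rule resolvent_disc_swap)
  have s: "star (star b - b) = - (star b - b)" by (simp add: star_simps)
  \<comment> \<open>This product differs from \<open>1 - star b * b\<close> by a skew element; the
    opposite product treats \<open>b * star b\<close> in the same way. Together they give inverses
    of \<open>1 - b\<close> on both sides.\<close>
  have "(1 + star b) * (1 - b) = 1 - star b * b + (star b - b)" by (simp add: algebra_simps)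
  also have "\<dots> \<in> algebra_units" by (rule one_diff_plus_skew_unit[OF _ 1 s]) (simp add: star_simps)
  finally have l: "(1 + star b) * (1 - b) \<in> algebra_units" .
  have "(1 - b) * (1 + star b) = 1 - b * star b + (star b - b)" by (simp add: algebra_simps)
  also have "\<dots> \<in> algebra_units" by (rule one_diff_plus_skew_unit[OF _ 2 s]) (simp add: star_simps)
  finally have "1 - b \<in> algebra_units" by (rule unit_sandwich[OF l])
  then show "1 - c *\<^sub>C a \<in> algebra_units" by (simp add: b_def)
qed

text \<open>Write \<open>rho\<close> for the spectral radius. Ptak's inequality for
  \<open>h * k\<close> and a cyclic rotation give \<open>rho(h k)^2 \<le> rho(h^2 k^2)\<close>.
  Repeated squaring of both factors reaches high powers, whose product is close to 0; the induction
  descends from there.\<close>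

lemma resolvent_disc_mult:
  assumes h: "star h = h" "resolvent_disc 1 h" and k: "star k = k" "resolvent_disc 1 k"
  shows "resolvent_disc 1 (h * k)"
proof -
  obtain p where p: "continuous_seminorm p" "\<And>x::'a. p x < 1 \<Longrightarrow> resolvent_disc 1 x"
    using resolvent_disc_near_zero by blast
  interpret cont_seminorm p by unfold_locales (rule p)
  have "(\<lambda>n. h ^ n) \<longlonglongrightarrow> 0" "(\<lambda>n. k ^ n) \<longlonglongrightarrow> 0"
    using power_tendsto_zero[OF h(2)] power_tendsto_zero[OF k(2)] by simp_all
  then have "(\<lambda>n. p (h ^ n * k ^ n)) \<longlonglongrightarrow> p (0 * 0)" by (intro tendsto tendsto_mult)
  then have "\<forall>\<^sub>F n in sequentially. p (h ^ n * k ^ n) < 1" by (intro order_tendstoD) auto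
  then obtain N where "\<And>n. n \<ge> N \<Longrightarrow> p (h ^ n * k ^ n) < 1" by (auto simp: eventually_sequentially)
  then have base: "resolvent_disc 1 (h ^ 2 ^ N * k ^ 2 ^ N)"
    using less_exp[of N] by (intro p(2)) (auto intro: less_imp_le)
  have "resolvent_disc 1 (h ^ 2 ^ (N - i) * k ^ 2 ^ (N - i))" if "i \<le> N" for i
    using that
  proof (induction i)
    case (Suc i)
    define j where "j = N - Suc i"
    have j: "N - i = Suc j" using Suc.prems by (simp add: j_def)
    define h' k' where "h' = h ^ 2 ^ j" and "k' = k ^ 2 ^ j"
    have "resolvent_disc 1 ((h' * h' * k') * k')"
      using Suc j by (simp add: h'_def k'_def mult.assoc mult_2 flip: power_add)
    then have "resolvent_disc 1 (k' * (h' * h' * k'))" by (rule resolvent_disc_swap)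
    also have "k' * (h' * h' * k') = star (h' * k') * (h' * k')"
      by (simp add: star_mult h'_def k'_def star_power h k mult.assoc)
    finally have "resolvent_disc 1 (h' * k')" by (rule resolvent_disc_star_mult)
    then show ?case by (simp add: h'_def k'_def j_def)
  qed (use base in simp)
  from this[of N] show ?thesis by simp
qed

text \<open>For \<open>t > 0\<close> the condition excludes \<open>-1 / t\<close> from the spectrum,
  so in a hermitian algebra the spectrum of \<open>h\<close> lies in the nonnegative reals.\<close>

definition pos :: "'a \<Rightarrow> bool"
  where "pos h \<longleftrightarrow> star h = h \<and> (\<forall>t\<ge>0. 1 + of_real t *\<^sub>C h \<in> algebra_units)"

lemma pos_star: "pos h \<Longrightarrow> star h = h"
  by (simp add: pos_def)

lemma pos_scale: "pos h \<Longrightarrow> t \<ge> 0 \<Longrightarrow> pos (of_real t *\<^sub>C h)"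
  by (auto simp: pos_def star_simps simp flip: of_real_mult)

lemma pos_unit:
  assumes h: "pos h" and u: "\<not> (Im u = 0 \<and> Re u < 0)"
  shows "1 + u *\<^sub>C h \<in> algebra_units"
proof (cases "Im u = 0")
  case True
  then have "u = of_real (Re u)" by (simp add: complex_eq_iff)
  moreover have "Re u \<ge> 0" using True u by simp
  ultimately show ?thesis using h unfolding pos_def by metis
next
  case False
  then have u0: "u \<noteq> 0" by auto
  have "- (1 / u) \<notin> \<real>"
    using False by (auto simp: complex_is_Real_iff Im_divide)
  then have "- (1 / u) *\<^sub>C 1 - h \<in> algebra_units" using pos_star[OF h] by (intro hermitian_resolvent)
  then have "(- u) *\<^sub>C (- (1 / u) *\<^sub>C 1 - h) \<in> algebra_units" using u0 by simp
  also have "(- u) *\<^sub>C (- (1 / u) *\<^sub>C 1 - h) = 1 + u *\<^sub>C h"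
    using u0 by (simp add: scaleC_linear)
  finally show ?thesis .
qed

text \<open>\<open>h'\<close> is the image of \<open>h\<close> under \<open>t / (1 + t)\<close>,
  which maps the nonnegative reals into \<open>[0, 1)\<close>. Concretely, \<open>1 - c h'\<close>
  is the inverse of \<open>1 + h\<close> times \<open>1 + (1 - c) h\<close>, and
  \<open>1 - c\<close> stays off the negative axis.\<close>

lemma pos_one_plus_inv_mult:
  assumes h: "pos h"
  defines "h' \<equiv> algebra_inv (1 + h) * h"
  shows "1 + h \<in> algebra_units" "star h' = h'" "h' = h * algebra_inv (1 + h)" "resolvent_disc 1 h'"
proof -
  show u: "1 + h \<in> algebra_units" using pos_unit[OF h, of 1] by simp
  show eq: "h' = h * algebra_inv (1 + h)"
    unfolding h'_def by (rule algebra_inv_commute[OF u]) (simp add: algebra_simps)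
  have "star h' = h * algebra_inv (1 + h)"
    by (simp add: h'_def star_mult star_inv[OF u] star_add pos_star[OF h])
  with eq show "star h' = h'" by simp
  show "resolvent_disc 1 h'"
    unfolding resolvent_disc_def
  proof safe
    fix c :: complex assume "norm c \<le> 1"
    then have "Re (1 - c) \<ge> 0" using complex_Re_le_cmod[of c] by simp
    then have "1 + (1 - c) *\<^sub>C h \<in> algebra_units" by (intro pos_unit[OF h]) simp
    with unit_inv[OF u] have "algebra_inv (1 + h) * (1 + (1 - c) *\<^sub>C h) \<in> algebra_units"
      by (rule unit_mult)
    also have "algebra_inv (1 + h) * (1 + (1 - c) *\<^sub>C h) = algebra_inv (1 + h) * (1 + h) - c *\<^sub>C h'"
      by (simp add: h'_def distrib_left scaleC_diff_left right_diff_distrib)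
    finally show "1 - c *\<^sub>C h' \<in> algebra_units" by (simp add: algebra_inv[OF u])
  qed
qed

text \<open>With \<open>h'\<close> and \<open>k'\<close> the images of \<open>h\<close> and
  \<open>k\<close> under \<open>t / (1 + t)\<close>, one has
  \<open>1 + h + k = (1 + h) * (1 - h' * k') * (1 + k)\<close>, and the product
  \<open>h' * k'\<close> has spectral radius below 1.\<close>

lemma pos_add:
  assumes "pos h" "pos k"
  shows "pos (h + k)"
proof -
  have *: "1 + (h + k) \<in> algebra_units" if h: "pos h" and k: "pos k" for h k
  proof -
    note h' = pos_one_plus_inv_mult[OF h] and k' = pos_one_plus_inv_mult[OF k]
    define d e where "d = algebra_inv (1 + h)" and "e = algebra_inv (1 + k)"
    have d: "(1 + h) * d = 1" and e: "e * (1 + k) = 1"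
      using algebra_inv[OF h'(1)] algebra_inv[OF k'(1)] by (simp_all add: d_def e_def)
    have "resolvent_disc 1 ((d * h) * (k * e))"
      using resolvent_disc_mult[OF h'(2,4) k'(2,4)] by (simp add: d_def e_def k'(3))
    then have "1 - (d * h) * (k * e) \<in> algebra_units"
      using resolvent_discD[of 1 _ 1] by simp
    then have "(1 + h) * (1 - (d * h) * (k * e)) * (1 + k) \<in> algebra_units"
      by (intro unit_mult h' k')
    also have "(1 + h) * (1 - (d * h) * (k * e)) * (1 + k) =
        (1 + h) * (1 + k) - ((1 + h) * d) * h * k * (e * (1 + k))"
      by (simp only: right_diff_distrib left_diff_distrib mult.assoc mult_1_left mult_1_right)
    also have "\<dots> = 1 + (h + k)" unfolding d e by (simp add: algebra_simps)
    finally show ?thesis .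
  qed
  show ?thesis
    unfolding pos_def
  proof (intro conjI allI impI)
    show "star (h + k) = h + k" using assms by (simp add: star_add pos_star)
    fix t :: real assume "t \<ge> 0"
    with *[OF pos_scale pos_scale, OF assms(1) _ assms(2), of t t]
    show "1 + of_real t *\<^sub>C (h + k) \<in> algebra_units" by (simp add: scaleC_add_right)
  qed
qed

text \<open>\<open>1 + t k^2\<close> factors as \<open>(1 + c k) (1 - c k)\<close> with
  \<open>c = \<i> * sqrt t\<close>, and both \<open>c k\<close> and \<open>- c k\<close> are
  skew.\<close>

lemma pos_square:
  assumes "star k = k"
  shows "pos (k * k)"
  unfolding pos_def
proof (intro conjI allI impI)
  show "star (k * k) = k * k" by (simp add: star_mult assms)
  fix t :: real assume t: "t \<ge> 0"
  define c where "c = \<i> * of_real (sqrt t)"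
  have c: "cnj c = - c" by (simp add: c_def)
  have "c * c = (\<i> * \<i>) * of_real (sqrt t * sqrt t)"
    by (simp only: c_def of_real_mult ac_simps)
  then have cc: "c * c = - of_real t" using t by simp
  have "1 + c *\<^sub>C k \<in> algebra_units" "1 + (- c) *\<^sub>C k \<in> algebra_units"
    by (rule one_plus_skew_unit, simp add: star_simps assms c scaleC_minus_left)+
  then have "(1 + c *\<^sub>C k) * (1 + (- c) *\<^sub>C k) \<in> algebra_units" by (rule unit_mult)
  also have "(1 + c *\<^sub>C k) * (1 + (- c) *\<^sub>C k) = 1 - (c * c) *\<^sub>C (k * k)"
    by (simp add: algebra_simps scaleC_linear)
  finally show "1 + of_real t *\<^sub>C (k * k) \<in> algebra_units"
    by (simp add: cc scaleC_minus_left)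
qed

text \<open>If \<open>1 + t a\<^sup>* a\<close> were not invertible for some \<open>t > 0\<close>, then, after rescaling, \<open>x = a\<^sup>* a\<close> has
  \<open>1 + x\<close> invertible but not \<open>1 + 2 x\<close>. The element \<open>b = 2 a (1 + x)\<^sup>-\<^sup>1\<close> satisfies
  \<open>1 - b\<^sup>* b = ((1 - x) (1 + x)\<^sup>-\<^sup>1)\<^sup>2\<close>, and the spectral value \<open>-1/2\<close> of \<open>x\<close> becomes \<open>-8\<close> for \<open>b\<^sup>* b\<close>;
  but \<open>b\<^sup>* b + b b\<^sup>*\<close> is a sum of squares and so \<open>b b\<^sup>*\<close> is bounded below by \<open>-1\<close>.\<close>

lemma pos_star_mult_aux:
  assumes u: "1 + star a * a \<in> algebra_units"
  shows "1 + 2 *\<^sub>C (star a * a) \<in> algebra_units"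
proof -
  define x where "x = star a * a"
  define d where "d = algebra_inv (1 + x)"
  define b where "b = 2 *\<^sub>C (a * d)"
  have x: "star x = x" by (simp add: x_def star_mult)
  have u: "1 + x \<in> algebra_units" using u by (simp add: x_def)
  have d: "(1 + x) * d = 1" using algebra_inv[OF u] by (simp add: d_def)
  have dx: "d * x = x * d"
    unfolding d_def by (rule algebra_inv_commute[OF u]) (simp add: algebra_simps)
  have dd: "d + x * d = 1" "d * z + x * (d * z) = z" for z
  proof -
    show 1: "d + x * d = 1" using d by (simp add: algebra_simps)
    show "d * z + x * (d * z) = z" using arg_cong[OF 1, of "\<lambda>y. y * z"] by (simp add: algebra_simps)
  qed
  have ds: "star d = d" by (simp add: d_def star_inv[OF u] star_add x)
  have bb: "star b * b = 4 *\<^sub>C (x * (d * d))"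
  proof -
    have "star b * b = 4 *\<^sub>C (d * x * d)"
      by (simp add: b_def star_simps ds x_def mult.assoc)
    then show ?thesis by (simp add: dx mult.assoc)
  qed
  define y where "y = (1 - x) * d"
  have ys: "star y = y" by (simp add: y_def star_simps ds x algebra_simps dx)
  have "1 = ((1 + x) * d) * ((1 + x) * d)" by (simp add: d)
  also have "\<dots> = (1 + x) * (1 + x) * (d * d)"
    by (simp add: algebra_simps) (simp add: dx algebra_simps flip: mult.assoc[of d x])
  finally have one: "1 = (1 + x) * (1 + x) * (d * d)" .
  have "y * y = (1 - x) * (1 - x) * (d * d)"
    unfolding y_def by (simp add: algebra_simps) (simp add: dx algebra_simps flip: mult.assoc[of d x])
  also have "\<dots> = (1 + x) * (1 + x) * (d * d) - 4 *\<^sub>C (x * (d * d))"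
  proof -
    have 4: "4 *\<^sub>C z = z + z + z + z" for z :: 'a
      using scaleC_add_left[of 2 2 z] scaleC_add_left[of 1 1 z] by (simp add: add.assoc)
    show ?thesis unfolding 4 by (simp add: algebra_simps)
  qed
  finally have yy: "y * y = 1 - star b * b" by (simp add: bb flip: one)
  define k m where "k = b + star b" and "m = \<i> *\<^sub>C (b - star b)"
  have km: "star k = k" "star m = m" by (simp_all add: k_def m_def star_simps scaleC_linear)
  \<comment> \<open>The sum in brackets equals \<open>1 + b * star b\<close>, because
    \<open>k * k + m * m\<close> is twice \<open>star b * b + b * star b\<close>. The factor
    \<open>1 / 7\<close> is chosen so that adding 1 gives a multiple of
    \<open>8 + b * star b\<close>.\<close>
  have "pos (of_real (1 / 7) *\<^sub>C (y * y + of_real (1 / 2) *\<^sub>C (k * k) + of_real (1 / 2) *\<^sub>C (m * m)))"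
    by (intro pos_scale pos_add pos_square km ys) auto
  from pos_unit[OF this, of 1]
  have "7 *\<^sub>C (1 + (1 / 7) *\<^sub>C (y * y + (1 / 2) *\<^sub>C (k * k) + (1 / 2) *\<^sub>C (m * m))) \<in> algebra_units"
    by simp
  also have "7 *\<^sub>C (1 + (1 / 7) *\<^sub>C (y * y + (1 / 2) *\<^sub>C (k * k) + (1 / 2) *\<^sub>C (m * m))) =
      7 *\<^sub>C 1 + (y * y + (1 / 2) *\<^sub>C (k * k + m * m))"
    by (simp add: scaleC_add_right add.assoc)
  also have "k * k + m * m = 2 *\<^sub>C (star b * b + b * star b)"
  proof -
    have 2: "2 *\<^sub>C z = z + z" for z :: 'a
      using scaleC_add_left[of 1 1 z] by simp
    show ?thesis unfolding 2 by (simp add: k_def m_def algebra_simps scaleC_linear)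
  qed
  also have "7 *\<^sub>C 1 + (y * y + (1 / 2) *\<^sub>C (2 *\<^sub>C (star b * b + b * star b))) = 8 *\<^sub>C 1 + b * star b"
    using scaleC_add_left[of 7 1 "1 :: 'a"] by (simp add: yy algebra_simps)
  finally have "(1 / 8) *\<^sub>C (8 *\<^sub>C 1 + b * star b) \<in> algebra_units" by simp
  then have "1 - ((- 1 / 8) *\<^sub>C b) * star b \<in> algebra_units"
    by (simp add: scaleC_add_right scaleC_minus_left)
  then have "1 - star b * ((- 1 / 8) *\<^sub>C b) \<in> algebra_units" by (rule unit_one_diff_swap)
  then have "8 *\<^sub>C (1 - star b * ((- 1 / 8) *\<^sub>C b)) \<in> algebra_units" by simp
  also have "8 *\<^sub>C (1 - star b * ((- 1 / 8) *\<^sub>C b)) = 8 *\<^sub>C 1 + star b * b"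
    by (simp add: scaleC_linear)
  also have "\<dots> = 8 *\<^sub>C ((1 + x) * (1 + x) * (d * d)) + 4 *\<^sub>C (x * (d * d))"
    by (simp only: bb flip: one)
  also have "\<dots> = (8 *\<^sub>C ((1 + x) * (1 + x)) + 4 *\<^sub>C x) * (d * d)"
    by (simp add: distrib_right)
  finally have "8 *\<^sub>C ((1 + x) * (1 + x)) + 4 *\<^sub>C x \<in> algebra_units"
    by (rule unit_mult_cancel_right[rotated]) (auto simp: d_def intro!: unit_mult unit_inv u)
  \<comment> \<open>The equation \<open>4 t / (1 + t)^2 = -8\<close> is invariant under
    \<open>t -> 1 / t\<close>; its solutions \<open>-1/2\<close> and \<open>-2\<close> give the two
    factors.\<close>
  also have "8 *\<^sub>C ((1 + x) * (1 + x)) + 4 *\<^sub>C x = (1 + 2 *\<^sub>C x) * (8 *\<^sub>C 1 + 4 *\<^sub>C x)"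
  proof -
    have "8 *\<^sub>C ((1 + x) * (1 + x)) + 4 *\<^sub>C x = 8 *\<^sub>C 1 + (8 + 8 + 4) *\<^sub>C x + 8 *\<^sub>C (x * x)"
      by (simp only: scaleC_add_left scaleC_add_right distrib_left distrib_right mult_1_left
          mult_1_right ac_simps)
    moreover have "(1 + 2 *\<^sub>C x) * (8 *\<^sub>C 1 + 4 *\<^sub>C x) =
        8 *\<^sub>C 1 + (4 + 2 * 8) *\<^sub>C x + (2 * 4) *\<^sub>C (x * x)"
      by (simp only: scaleC_add_left scaleC_add_right distrib_left distrib_right mult_1_left
          mult_1_right mult_scaleC_left mult_scaleC_right scaleC_scaleC ac_simps)
    ultimately show ?thesis by simp
  qed
  finally have "1 + 2 *\<^sub>C x \<in> algebra_units"
    by (rule unit_commuting_factor) (simp add: algebra_simps scaleC_linear)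
  then show ?thesis by (simp add: x_def)
qed

text \<open>By the preceding lemma, applied to a multiple of \<open>a\<close>, a failure at
  \<open>t\<close> forces a failure at \<open>t / 2\<close>. Failures are bounded away from 0, so
  one within a factor 2 of their infimum is contradictory.\<close>

lemma pos_star_mult: "pos (star a * a)"
proof (rule ccontr)
  assume "\<not> pos (star a * a)"
  define T where "T = {t. t \<ge> 0 \<and> 1 + of_real t *\<^sub>C (star a * a) \<notin> algebra_units}"
  have "T \<noteq> {}"
    using \<open>\<not> pos _\<close> by (auto simp: T_def pos_def star_mult)
  obtain R where R: "R > 0" "resolvent_disc R (star a * a)"
    using resolvent_disc_exists by blast
  have T_ge: "R \<le> t" if "t \<in> T" for t
  proof (rule ccontr)
    assume "\<not> R \<le> t"
    with that resolvent_discD[OF R(2), of "- of_real t"] show False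
      by (auto simp: T_def scaleC_minus_left)
  qed
  have bdd: "bdd_below T" using T_ge by (rule bdd_belowI)
  have "R \<le> Inf T" by (rule cInf_greatest[OF \<open>T \<noteq> {}\<close> T_ge])
  with R(1) have "Inf T < 2 * Inf T" by simp
  then obtain t where t: "t \<in> T" "t < 2 * Inf T"
    using cInf_lessD[OF \<open>T \<noteq> {}\<close>] by blast
  then have "t > 0" using T_ge[OF t(1)] R(1) by simp
  have "t / 2 \<notin> T" using cInf_lower[OF _ bdd, of "t / 2"] t(2) by force
  define c where "c = of_real (sqrt (t / 2)) *\<^sub>C a"
  have "star c * c = of_real (sqrt (t / 2) * sqrt (t / 2)) *\<^sub>C (star a * a)"
    by (simp add: c_def star_simps del: real_sqrt_mult_self)
  also have "sqrt (t / 2) * sqrt (t / 2) = t / 2" using \<open>t > 0\<close> by simp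
  finally have c: "star c * c = of_real (t / 2) *\<^sub>C (star a * a)" .
  have "1 + star c * c \<in> algebra_units"
    unfolding c using \<open>t / 2 \<notin> T\<close> \<open>t > 0\<close> by (auto simp: T_def)
  from pos_star_mult_aux[OF this] t(1) show False
    by (simp add: c T_def)
qed

lemma polar_sqrt_exists:
  assumes h: "h \<in> algebra_units"
  shows "\<exists>w. w * w = star h * h \<and> star w = w \<and> w \<in> algebra_units \<and>
    (\<forall>z. z * (star h * h) = (star h * h) * z \<longrightarrow> z * w = w * z)"
proof -
  define a where "a = star h * h"
  have a: "pos a" "a \<in> algebra_units" "star a = a"
    using pos_star_mult unit_mult[OF star_unit[OF h] h] by (simp_all add: a_def star_mult)
  obtain e where e: "e > 0" "resolvent_disc e a" using resolvent_disc_exists by blast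
  define x where "x = 1 - of_real e *\<^sub>C a"
  have "resolvent_disc 1 x"
    unfolding resolvent_disc_def
  proof safe
    fix c :: complex assume c: "norm c \<le> 1"
    show "1 - c *\<^sub>C x \<in> algebra_units"
    \<comment> \<open>For \<open>c = 1\<close> the element is \<open>e a\<close>, a unit because
      \<open>h\<close> is one.\<close>
    proof (cases "c = 0 \<or> c = 1")
      case True
      then show ?thesis using a(2) e(1) by (auto simp: x_def)
    next
      case False
      \<comment> \<open>In \<open>1 - c x = (1 - c) + c e a\<close>, factoring out
        \<open>c u = 1 - c\<close> leaves \<open>1 + (e / u) a\<close>, the form that positivity of
        \<open>a\<close> controls.\<close>
      define u where "u = 1 / c - 1"
      have u0: "u \<noteq> 0" "c \<noteq> 0" using False by (auto simp: u_def)
      have "1 + (of_real e / u) *\<^sub>C a \<in> algebra_units"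
      \<comment> \<open>Positivity covers \<open>e / u\<close> off the negative axis. On it,
        \<open>u = r < 0\<close> and \<open>1 / c = r + 1\<close> has modulus at least 1, so
        \<open>r \<le> - 2\<close>; then \<open>e / u\<close> has modulus at most \<open>e\<close>,
        and the resolvent disc of \<open>a\<close> applies.\<close>
      proof (cases "Im (of_real e / u) = 0 \<and> Re (of_real e / u) < 0")
        case True
        then have "of_real e / u = of_real (Re (of_real e / u))" by (simp add: complex_eq_iff)
        then have "u = of_real (e / Re (of_real e / u))"
          using u0 e(1) by (metis of_real_divide nonzero_divide_eq_eq nonzero_eq_divide_eq
              divide_eq_0_iff of_real_eq_0_iff less_irrefl mult.commute)
        moreover have "e / Re (of_real e / u) < 0" using True e(1) by (simp add: divide_pos_neg)
        ultimately obtain r where r: "u = of_real r" "r < 0" by metis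
        have "norm (1 / c) \<ge> 1" using c u0 by (simp add: norm_divide)
        also have "1 / c = of_real (r + 1)" using r by (simp add: u_def algebra_simps)
        finally have "\<bar>r + 1\<bar> \<ge> 1" by (simp only: norm_of_real)
        with r have "r \<le> - 2" by linarith
        then have "e / \<bar>r\<bar> \<le> e / 1" using e(1) by (intro divide_left_mono) auto
        then have "norm (- (of_real e / u)) \<le> e"
          using e(1) by (simp add: r norm_divide)
        from resolvent_discD[OF e(2) this] show ?thesis by (simp add: scaleC_minus_left)
      qed (rule pos_unit[OF a(1)])
      then have "(c * u) *\<^sub>C (1 + (of_real e / u) *\<^sub>C a) \<in> algebra_units" using u0 by simp
      also have "(c * u) *\<^sub>C (1 + (of_real e / u) *\<^sub>C a) = (c * u) *\<^sub>C 1 + (c * of_real e) *\<^sub>C a"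
        using u0 by (simp add: scaleC_add_right)
      also have "c * u = 1 - c" using u0 by (simp add: u_def algebra_simps)
      also have "(1 - c) *\<^sub>C 1 + (c * of_real e) *\<^sub>C a = 1 - c *\<^sub>C x"
        by (simp add: x_def scaleC_linear)
      finally show ?thesis .
    qed
  qed
  moreover have "star x = x" by (simp add: x_def star_simps a)
  ultimately obtain b where b: "b * b = 1 - x" "star b = b" "\<And>z. z * x = x * z \<Longrightarrow> z * b = b * z"
    using self_adjoint_sqrt_exists by metis
  define r where "r = 1 / sqrt e"
  define w where "w = of_real r *\<^sub>C b"
  have "w * w = of_real (r * r) *\<^sub>C (b * b)"
    by (simp add: w_def)
  also have "r * r = 1 / e" using e(1) by (simp add: r_def)
  also have "of_real (1 / e) *\<^sub>C (b * b) = a" using e(1) by (simp add: b x_def)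
  finally have ww: "w * w = a" .
  moreover have "star w = w" by (simp add: w_def star_simps b)
  moreover have "w \<in> algebra_units" using ww a(2) unit_commuting_factor by metis
  moreover have "z * w = w * z" if "z * a = a * z" for z
    using b(3)[of z] that by (simp add: w_def x_def algebra_simps)
  ultimately show ?thesis unfolding a_def by blast
qed

end

section \<open>Polar decomposition and self-adjoint flags\<close>

context hermitian_cia
begin

text \<open>\<open>u\<close> depends on \<open>h\<close> alone, so one unitary serves all pairs
  \<open>p\<close>, \<open>q\<close> at once, as a whole chain requires.\<close>

lemma unitary_intertwiner:
  assumes h: "h \<in> algebra_units"
  shows "\<exists>u\<in>algebra_units. star u * u = 1 \<and>
    (\<forall>p q. star p = p \<longrightarrow> star q = q \<longrightarrow> h * p = q * h \<longrightarrow> u * p = q * u)"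
proof -
  obtain w where w: "w * w = star h * h" "star w = w" "w \<in> algebra_units"
      "\<And>z. z * (star h * h) = (star h * h) * z \<Longrightarrow> z * w = w * z"
    using polar_sqrt_exists[OF h] by blast
  define d where "d = algebra_inv w"
  have d: "w * d = 1" "d * w = 1" "star d = d" "d \<in> algebra_units"
    using algebra_inv[OF w(3)] unit_inv[OF w(3)] by (simp_all add: d_def star_inv w)
  have "star (h * d) * (h * d) = d * (w * w) * d"
    by (simp add: star_mult d w(1) mult.assoc)
  also have "\<dots> = (d * w) * (w * d)" by (simp only: mult.assoc)
  finally have "star (h * d) * (h * d) = 1" by (simp add: d)
  moreover have "h * d * p = q * (h * d)" if "star p = p" "star q = q" "h * p = q * h" for p q
  proof -
    have "p * star h = star h * q" using arg_cong[OF that(3), of star] by (simp only: star_mult that(1,2))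
    then have "p * (star h * h) = (star h * h) * p" using that(3) by (metis mult.assoc)
    then have "w * p = p * w" using w(4)[of p] by simp
    then have "d * p = p * d" unfolding d_def by (rule algebra_inv_commute[OF w(3)])
    then show ?thesis using that(3) by (metis mult.assoc)
  qed
  ultimately show ?thesis using unit_mult[OF h d(4)] by blast
qed

text \<open>Kaplansky's formula \<open>q = p p\<^sup>* (1 - (p - p\<^sup>*)\<^sup>2)\<^sup>-\<^sup>1\<close> for the self-adjoint idempotent with the
  same right ideal.\<close>

lemma self_adjoint_idempotent_exists:
  assumes p: "p * p = p"
  shows "\<exists>q. star q = q \<and> q * q = q \<and> idem_sim p q"
proof -
  define s where "s = p - star p"
  define z where "z = 1 - s * s"
  have pp: "star p * star p = star p" using p by (simp flip: star_mult)
  have ppx: "p * (p * x) = p * x" "star p * (star p * x) = star p * x" for x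
    using p pp by (simp_all flip: mult.assoc)
  have "star s = - s" by (simp add: s_def star_simps)
  then have "1 + s \<in> algebra_units" "1 + - s \<in> algebra_units"
    by (rule_tac one_plus_skew_unit; simp add: star_minus)+
  then have "(1 + s) * (1 + - s) \<in> algebra_units" by (rule unit_mult)
  then have zu: "z \<in> algebra_units" by (simp add: z_def algebra_simps)
  \<comment> \<open>Idempotency collapses the mixed terms: \<open>z * p\<close> and
    \<open>p * z\<close> are both \<open>p * star p * p\<close>. So \<open>z\<close> and its inverse
    commute with \<open>p\<close>, likewise with \<open>star p\<close>, and the inverse of
    \<open>z\<close> turns \<open>p * star p * p\<close> into \<open>p\<close>.\<close>
  have zp: "z * p = p * (star p * p)" "p * z = p * (star p * p)"
    by (simp_all add: z_def s_def algebra_simps p pp ppx)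
  have zs: "z * star p = star p * (p * star p)" "star p * z = star p * (p * star p)"
    by (simp_all add: z_def s_def algebra_simps p pp ppx)
  define e where "e = algebra_inv z"
  have e: "z * e = 1" "e * z = 1" using algebra_inv[OF zu] by (simp_all add: e_def)
  have ep: "e * p = p * e" unfolding e_def by (rule algebra_inv_commute[OF zu]) (simp add: zp)
  have es: "e * star p = star p * e" unfolding e_def by (rule algebra_inv_commute[OF zu]) (simp add: zs)
  have "star z = z" by (simp add: z_def s_def star_simps algebra_simps)
  then have se: "star e = e" by (simp add: e_def star_inv[OF zu])
  define q where "q = p * star p * e"
  have "star q = q" unfolding q_def by (simp add: star_mult se) (metis ep es mult.assoc)
  moreover have pq: "p * q = q" by (simp add: q_def ppx mult.assoc)
  moreover have qp: "q * p = p"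
  proof -
    have "q * p = p * (star p * p) * e" by (simp add: q_def mult.assoc ep)
    also have "\<dots> = p * (z * e)" by (metis zp(2) mult.assoc)
    finally show ?thesis by (simp add: e)
  qed
  moreover have "q * q = q"
    by (metis pq qp mult.assoc)
  ultimately show ?thesis by (auto simp: idem_sim_def)
qed

end

lemma transp_idem_le: "transp (idem_le :: 'a::monoid_mult \<Rightarrow> _)"
  unfolding transp_def idem_le_def by (metis mult.assoc)

lemma idem_chains_nth:
  assumes "ps \<in> idem_chains n"
  shows "length ps = n" "i < n \<Longrightarrow> ps ! i * ps ! i = ps ! i"
    "i < j \<Longrightarrow> j < n \<Longrightarrow> ps ! j * ps ! i = ps ! i"
proof -
  show l: "length ps = n" using assms by (simp add: idem_chains_def)
  show "ps ! i * ps ! i = ps ! i" if "i < n"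
  proof -
    have "ps ! i \<in> idempotents" using assms that l by (auto simp: idem_chains_def)
    then show ?thesis by (simp add: idempotents_def)
  qed
  have "sorted_wrt idem_le ps"
    using assms successively_conv_sorted_wrt[OF transp_idem_le] by (auto simp: idem_chains_def)
  then show "ps ! j * ps ! i = ps ! i" if "i < j" "j < n"
    using that l by (auto simp: sorted_wrt_iff_nth_less idem_le_def)
qed

text \<open>The order depends only on the right ideals, so each entry can be replaced independently
  by a self-adjoint idempotent with the same right ideal.\<close>

lemma (in hermitian_cia) self_adjoint_chain_exists:
  assumes ps: "ps \<in> idem_chains n"
  shows "\<exists>qs. (ps, qs) \<in> flag_rel n \<and> (\<forall>i<n. star (qs ! i) = qs ! i)"
proof -
  have "\<forall>p\<in>set ps. \<exists>q. star q = q \<and> q * q = q \<and> idem_sim p q"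
    using ps by (auto simp: idem_chains_def idempotents_def intro!: self_adjoint_idempotent_exists)
  then obtain f where f: "\<And>p. p \<in> set ps \<Longrightarrow> star (f p) = f p \<and> f p * f p = f p \<and> idem_sim p (f p)"
    by metis
  have le: "idem_le (f p) (f q)" if "p \<in> set ps" "q \<in> set ps" "idem_le p q" for p q
    using f[OF that(1)] f[OF that(2)] that(3) unfolding idem_sim_def idem_le_def by (metis mult.assoc)
  have "successively idem_le ps" using ps by (simp add: idem_chains_def)
  then have "successively (\<lambda>p q. idem_le (f p) (f q)) ps"
    by (rule successively_mono) (use le in auto)
  then have "map f ps \<in> idem_chains n"
    using ps f by (auto simp: idem_chains_def successively_map idempotents_def)
  then have "(ps, map f ps) \<in> flag_rel n"
    using ps f by (auto simp: flag_rel_def list_all2_conv_all_nth)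
  moreover have "\<forall>i<n. star (map f ps ! i) = map f ps ! i"
    using f idem_chains_nth(1)[OF ps] by auto
  ultimately show ?thesis by blast
qed

text \<open>A unit mapping one flag onto another is block triangular with respect to the two flags; its
  block diagonal part maps the idempotents themselves onto each other.\<close>

lemma block_diagonal_unit:
  fixes P Q :: "nat \<Rightarrow> 'a::{ring, monoid_mult}"
  assumes P: "P 0 = 0" "P (Suc n) = 1" "\<And>i j. i \<le> j \<Longrightarrow> j \<le> Suc n \<Longrightarrow> P i * P j = P i \<and> P j * P i = P i"
    and Q: "Q 0 = 0" "Q (Suc n) = 1" "\<And>i j. i \<le> j \<Longrightarrow> j \<le> Suc n \<Longrightarrow> Q i * Q j = Q i \<and> Q j * Q i = Q i"
    and g: "g * g' = 1" "g' * g = 1"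
    and PQ: "\<And>i. i \<le> Suc n \<Longrightarrow> Q i * (g * P i) = g * P i"
    and QP: "\<And>i. i \<le> Suc n \<Longrightarrow> P i * (g' * Q i) = g' * Q i"
  shows "\<exists>h\<in>algebra_units. \<forall>i\<le>Suc n. h * P i = Q i * h"
proof -
  \<comment> \<open>Stated for arbitrary data because it is applied twice: exchanging
    \<open>P\<close>, \<open>g\<close> with \<open>Q\<close>, \<open>g'\<close> gives the other
    one-sided inverse.\<close>
  have diag: "(\<Sum>i\<le>n. (Q (Suc i) - Q i) * g * (P (Suc i) - P i)) *
      (\<Sum>i\<le>n. (P (Suc i) - P i) * g' * (Q (Suc i) - Q i)) = 1"
    if P: "\<And>i j. i \<le> j \<Longrightarrow> j \<le> Suc n \<Longrightarrow> P i * P j = P i \<and> P j * P i = P i"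
      and Q: "Q 0 = 0" "Q (Suc n) = 1" "\<And>i j. i \<le> j \<Longrightarrow> j \<le> Suc n \<Longrightarrow> Q i * Q j = Q i \<and> Q j * Q i = Q i"
      and g: "g * g' = 1"
      and PQ: "\<And>i. i \<le> Suc n \<Longrightarrow> Q i * (g * P i) = g * P i"
      and QP: "\<And>i. i \<le> Suc n \<Longrightarrow> P i * (g' * Q i) = g' * Q i"
    for P Q :: "nat \<Rightarrow> 'a" and g g'
  proof -
    define d e where "d i = P (Suc i) - P i" and "e i = Q (Suc i) - Q i" for i
    have dd: "d i * d j = (if i = j then d i else 0)" if "i \<le> n" "j \<le> n" for i j
    proof (cases i j rule: linorder_cases)
      case equal
      then show ?thesis using that P[of j j] P[of "Suc j" "Suc j"] P[of j "Suc j"]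
        by (simp add: d_def algebra_simps)
    qed (use that P[of i j] P[of "Suc i" j] P[of i "Suc j"] P[of "Suc i" "Suc j"]
        P[of j i] P[of "Suc j" i] P[of j "Suc i"] P[of "Suc j" "Suc i"] in
        \<open>simp_all add: d_def algebra_simps\<close>)
    \<comment> \<open>Between \<open>e i * g\<close> and \<open>g' * e i\<close> the factor
      \<open>d i\<close> acts as 1: by triangularity \<open>P (Suc i)\<close> fixes
      \<open>g' * e i\<close>, and \<open>e i * (g * P i)\<close> vanishes.\<close>
    have ee: "e i * (g * (d i * (g' * e i))) = e i" if "i \<le> n" for i
    proof -
      have e: "Q (Suc i) * e i = e i" "e i * Q i = 0" "e i * e i = e i"
        using that Q(3)[of i i] Q(3)[of "Suc i" "Suc i"] Q(3)[of i "Suc i"]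
        by (simp_all add: e_def algebra_simps)
      have "P (Suc i) * (g' * e i) = P (Suc i) * (g' * Q (Suc i)) * e i"
        using e(1) by (simp add: mult.assoc)
      also have "\<dots> = g' * e i" using that QP[of "Suc i"] e(1) by (simp add: mult.assoc)
      finally have 1: "P (Suc i) * (g' * e i) = g' * e i" .
      have "e i * (g * P i) = e i * Q i * (g * P i)" using that PQ[of i] by (simp add: mult.assoc)
      then have 2: "e i * (g * P i) = 0" by (simp add: e)
      have "e i * (g * (d i * (g' * e i))) = e i * ((g * g') * e i) - e i * (g * P i) * (g' * e i)"
        by (simp add: d_def left_diff_distrib right_diff_distrib 1 mult.assoc)
      then show ?thesis by (simp add: g 2 e)
    qed
    have "(\<Sum>i\<le>n. e i * g * d i) * (\<Sum>i\<le>n. d i * g' * e i) =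
        (\<Sum>i\<le>n. \<Sum>j\<le>n. e i * g * (d i * d j) * g' * e j)"
      by (simp add: sum_product mult.assoc)
    also have "\<dots> = (\<Sum>i\<le>n. \<Sum>j\<le>n. if i = j then e i * (g * (d i * (g' * e i))) else 0)"
      by (intro sum.cong refl) (auto simp: dd mult.assoc)
    also have "\<dots> = (\<Sum>i\<le>n. e i)"
      by (intro sum.cong refl) (simp add: ee)
    also have "\<dots> = 1"
      unfolding e_def using sum_lessThan_telescope[of Q "Suc n"] by (simp add: Q lessThan_Suc_atMost)
    finally show ?thesis by (simp add: d_def e_def)
  qed
  define h where "h = (\<Sum>i\<le>n. (Q (Suc i) - Q i) * g * (P (Suc i) - P i))"
  have "h \<in> algebra_units"
    unfolding h_def using diag[OF P(3) Q g(1) PQ QP] diag[OF Q(3) P g(2) QP PQ]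
    by (rule algebra_unitI)
  moreover have "h * P j = Q j * h" if j: "j \<le> Suc n" for j
  proof -
    have "(Q (Suc i) - Q i) * g * (P (Suc i) - P i) * P j = Q j * ((Q (Suc i) - Q i) * g * (P (Suc i) - P i))"
      if i: "i \<le> n" for i
    proof (cases "i < j")
      case True
      then have "(P (Suc i) - P i) * P j = P (Suc i) - P i" "Q j * (Q (Suc i) - Q i) = Q (Suc i) - Q i"
        using P(3)[of "Suc i" j] P(3)[of i j] Q(3)[of "Suc i" j] Q(3)[of i j] j
        by (auto simp: left_diff_distrib right_diff_distrib)
      then show ?thesis by (simp add: mult.assoc) (simp flip: mult.assoc)
    next
      case False
      then have "(P (Suc i) - P i) * P j = 0" "Q j * (Q (Suc i) - Q i) = 0"
        using P(3)[of j "Suc i"] P(3)[of j i] Q(3)[of j "Suc i"] Q(3)[of j i] i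
        by (auto simp: left_diff_distrib right_diff_distrib)
      then show ?thesis by (simp add: mult.assoc) (simp flip: mult.assoc)
    qed
    then show ?thesis unfolding h_def sum_distrib_left sum_distrib_right by (intro sum.cong) auto
  qed
  ultimately show ?thesis by blast
qed

lemma (in hermitian_cia) unitary_between_chains:
  assumes ps: "ps \<in> idem_chains n" "\<And>i. i < n \<Longrightarrow> star (ps ! i) = ps ! i"
    and qs: "qs \<in> idem_chains n" "\<And>i. i < n \<Longrightarrow> star (qs ! i) = qs ! i"
    and g: "g \<in> algebra_units" "(map (\<lambda>p. g * p * algebra_inv g) ps, qs) \<in> flag_rel n"
  shows "\<exists>u\<in>algebra_units. star u * u = 1 \<and> map (\<lambda>p. u * p * algebra_inv u) ps = qs"
proof -
  \<comment> \<open>Padding with 0 in front and 1 behind makes the successive differences sum to 1;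
    list position \<open>i\<close> becomes index \<open>Suc i\<close>.\<close>
  define ext where "ext rs i = (if i = 0 then 0 else if i \<le> n then rs ! (i - 1) else 1 :: 'a)" for rs i
  have ext_star: "star (ext rs i) = ext rs i" if "\<And>i. i < n \<Longrightarrow> star (rs ! i) = rs ! i" for rs i
    using that by (auto simp: ext_def)
  have ext_mult: "ext rs i * ext rs j = ext rs i \<and> ext rs j * ext rs i = ext rs i"
    if rs: "rs \<in> idem_chains n" "\<And>i. i < n \<Longrightarrow> star (rs ! i) = rs ! i" and ij: "i \<le> j" for rs i j
  proof -
    have 1: "ext rs j * ext rs i = ext rs i"
      using ij idem_chains_nth[OF rs(1)] by (cases "i = j") (auto simp: ext_def)
    from arg_cong[OF this, of star] have "ext rs i * ext rs j = ext rs i"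
      by (simp add: star_mult ext_star[OF rs(2)])
    with 1 show ?thesis by simp
  qed
  define g' where "g' = algebra_inv g"
  have g': "g * g' = 1" "g' * g = 1" using algebra_inv[OF g(1)] by (simp_all add: g'_def)
  have sim: "idem_sim (g * ps ! i * g') (qs ! i)" if "i < n" for i
    using g(2) that idem_chains_nth(1)[OF ps(1)]
    by (auto simp: flag_rel_def list_all2_conv_all_nth g'_def)
  have "qs ! i * (g * ps ! i) = g * ps ! i" "ps ! i * (g' * qs ! i) = g' * qs ! i" if "i < n" for i
  proof -
    have 1: "g * ps ! i * g' * qs ! i = qs ! i" "qs ! i * (g * ps ! i * g') = g * ps ! i * g'"
      using sim[OF that] by (auto simp: idem_sim_def)
    show "qs ! i * (g * ps ! i) = g * ps ! i"
      using arg_cong[OF 1(2), of "\<lambda>x. x * g"] by (simp add: mult.assoc g')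
    show "ps ! i * (g' * qs ! i) = g' * qs ! i"
      using arg_cong[OF 1(1), of "\<lambda>x. g' * x"] g'(2) by (simp add: mult.assoc) (simp flip: mult.assoc)
  qed
  then have "ext qs i * (g * ext ps i) = g * ext ps i \<and> ext ps i * (g' * ext qs i) = g' * ext qs i" for i
    by (auto simp: ext_def)
  then have "\<exists>h\<in>algebra_units. \<forall>i\<le>Suc n. h * ext ps i = ext qs i * h"
    by (intro block_diagonal_unit[OF _ _ ext_mult[OF ps] _ _ ext_mult[OF qs] g']) (auto simp: ext_def)
  then obtain h where h: "h \<in> algebra_units" "\<And>i. i \<le> Suc n \<Longrightarrow> h * ext ps i = ext qs i * h" by blast
  obtain u where u: "u \<in> algebra_units" "star u * u = 1"
      "\<And>p q. star p = p \<Longrightarrow> star q = q \<Longrightarrow> h * p = q * h \<Longrightarrow> u * p = q * u"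
    using unitary_intertwiner[OF h(1)] by blast
  have "u * ps ! i * algebra_inv u = qs ! i" if "i < n" for i
  proof -
    have "h * ps ! i = qs ! i * h" using h(2)[of "Suc i"] that by (simp add: ext_def)
    then have "u * ps ! i = qs ! i * u" using ps(2) qs(2) that by (intro u(3)) auto
    then show ?thesis by (simp add: mult.assoc algebra_inv[OF u(1)])
  qed
  then have "map (\<lambda>p. u * p * algebra_inv u) ps = qs"
    using idem_chains_nth(1)[OF ps(1)] idem_chains_nth(1)[OF qs(1)] by (auto intro: nth_equalityI)
  with u show ?thesis by blast
qed


section \<open>The action on flags\<close>

lemma flag_act_Flags:
  fixes g :: "'a::monoid_mult"
  assumes g: "g \<in> algebra_units" and Y: "Y \<in> Flags n"
  shows "flag_act n g Y \<in> Flags n"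
proof -
  obtain ps where ps: "ps \<in> idem_chains n" "Y = flag_rel n `` {ps}"
    using Y by (auto simp: Flags_def elim!: quotientE)
  show ?thesis
    unfolding ps(2) flag_act_class[OF g ps(1)] Flags_def
    by (rule quotientI[OF map_conj_idem_chains[OF g ps(1)]])
qed

lemma flag_act_mult:
  fixes g h :: "'a::monoid_mult"
  assumes g: "g \<in> algebra_units" and h: "h \<in> algebra_units" and Y: "Y \<in> Flags n"
  shows "flag_act n (g * h) Y = flag_act n g (flag_act n h Y)"
proof -
  obtain ps where ps: "ps \<in> idem_chains n" "Y = flag_rel n `` {ps}"
    using Y by (auto simp: Flags_def elim!: quotientE)
  show ?thesis
    unfolding ps(2) flag_act_class[OF h ps(1)] flag_act_class[OF g map_conj_idem_chains[OF h ps(1)]]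
      flag_act_class[OF unit_mult[OF g h] ps(1)]
    by (simp add: comp_def algebra_inv_mult[OF g h] mult.assoc)
qed

lemma flag_act_one:
  fixes Y :: "'a::monoid_mult list set"
  assumes Y: "Y \<in> Flags n"
  shows "flag_act n 1 Y = Y"
proof -
  obtain ps where ps: "ps \<in> idem_chains n" "Y = flag_rel n `` {ps}"
    using Y by (auto simp: Flags_def elim!: quotientE)
  have "algebra_inv 1 = (1::'a)" by (rule algebra_inv_eqI) auto
  then show ?thesis
    unfolding ps(2) flag_act_class[OF one_unit ps(1)] by simp
qed

text \<open>\<open>f (inv g)\<close> inverts \<open>f g\<close>, so each map is a bijection of
  \<open>E\<close>. The elements of \<open>BijGroup E\<close> are extensional on \<open>E\<close>,
  hence the \<open>restrict\<close>.\<close>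

lemma group_actionI:
  fixes G (structure)
  assumes "group G"
    and closed: "\<And>g y. g \<in> carrier G \<Longrightarrow> y \<in> E \<Longrightarrow> f g y \<in> E"
    and one: "\<And>y. y \<in> E \<Longrightarrow> f \<one> y = y"
    and mult: "\<And>g h y. g \<in> carrier G \<Longrightarrow> h \<in> carrier G \<Longrightarrow> y \<in> E \<Longrightarrow> f (g \<otimes> h) y = f g (f h y)"
  shows "group_action G E (\<lambda>g. restrict (f g) E)"
proof -
  interpret group G by fact
  have bij: "restrict (f g) E \<in> Bij E" if g: "g \<in> carrier G" for g
  proof -
    have "bij_betw (f g) E E"
      by (rule bij_betwI[of _ _ _ "f (inv g)"])
        (use g closed mult[of g "inv g"] mult[of "inv g" g] one in auto)
    then show ?thesis by (simp add: Bij_def cong: bij_betw_cong)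
  qed
  have "(\<lambda>g. restrict (f g) E) \<in> hom G (BijGroup E)"
  proof (rule homI)
    fix g h assume gh: "g \<in> carrier G" "h \<in> carrier G"
    show "restrict (f (g \<otimes> h)) E = restrict (f g) E \<otimes>\<^bsub>BijGroup E\<^esub> restrict (f h) E"
      using gh bij closed mult by (auto simp: BijGroup_def compose_def restrict_def fun_eq_iff)
  qed (use bij in \<open>simp add: BijGroup_def\<close>)
  then show ?thesis
    by (intro group_action.intro group_hom.intro group_hom_axioms.intro group_BijGroup is_group)
qed

lemma (in hermitian_cia) group_unitary_group: "group (unitary_group star)"
proof (rule groupI)
  fix u assume "u \<in> carrier (unitary_group star)"
  then have u: "u \<in> algebra_units" "star u * u = 1" by (auto simp: unitary_group_def)
  have "u * star u = 1"
    using algebra_inv[OF u(1)] u(2) by (metis mult.assoc mult_1_left mult_1_right)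
  then show "\<exists>v\<in>carrier (unitary_group star). v \<otimes>\<^bsub>unitary_group star\<^esub> u = \<one>\<^bsub>unitary_group star\<^esub>"
    using u star_unit by (intro bexI[of _ "star u"]) (auto simp: unitary_group_def)
next
  fix u v assume "u \<in> carrier (unitary_group star)" "v \<in> carrier (unitary_group star)"
  then have uv: "u \<in> algebra_units" "star u * u = 1" "v \<in> algebra_units" "star v * v = 1"
    by (auto simp: unitary_group_def)
  have "star (u * v) * (u * v) = star v * (star u * u) * v" by (simp add: star_mult mult.assoc)
  with uv show "u \<otimes>\<^bsub>unitary_group star\<^esub> v \<in> carrier (unitary_group star)"
    by (simp add: unitary_group_def unit_mult)
qed (auto simp: unitary_group_def mult.assoc)

theorem theorem4p5:
  fixes star :: "'a::{continuous_inverse_algebra, Mackey_complete_space} \<Rightarrow> 'a"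
    and n :: nat
    and X :: "'a list set"
  assumes "is_hermitian star"
    and "n \<ge> 1"
    and "X \<in> Flags n"
  shows "transitive_action (unitary_group star) (flag_manifold n X)
    (\<lambda>u. restrict (flag_act n u) (flag_manifold n X))"
proof -
  interpret hermitian_cia star by unfold_locales (rule assms(1))
  define E where "E = flag_manifold n X"
  have E: "E = {flag_act n g X |g. g \<in> algebra_units}"
    by (simp add: E_def flag_manifold_def orbit_def unit_group_def)
  have E_Flags: "E \<subseteq> Flags n"
    using flag_act_Flags assms(3) by (auto simp: E)
  have closed: "flag_act n g Y \<in> E" if "g \<in> algebra_units" "Y \<in> E" for g Y
    using that assms(3) unfolding E by (auto simp flip: flag_act_mult intro: unit_mult)
  have trans: "\<exists>u\<in>carrier (unitary_group star). flag_act n u Y = Z" if YZ: "Y \<in> E" "Z \<in> E" for Y Z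
  proof -
    obtain a b where ab: "a \<in> algebra_units" "Y = flag_act n a X" "b \<in> algebra_units" "Z = flag_act n b X"
      using YZ by (auto simp: E)
    define g where "g = b * algebra_inv a"
    have g: "g \<in> algebra_units" using ab by (simp add: g_def unit_mult unit_inv)
    have "flag_act n g Y = flag_act n (g * a) X"
      unfolding ab(2) by (rule flag_act_mult[OF g ab(1) assms(3), symmetric])
    also have "g * a = b" by (simp add: g_def mult.assoc algebra_inv[OF ab(1)])
    finally have gY: "flag_act n g Y = Z" by (simp add: ab)
    have rep: "\<exists>ps\<in>idem_chains n. W = flag_rel n `` {ps} \<and> (\<forall>i<n. star (ps ! i) = ps ! i)"
      if "W \<in> E" for W
    proof -
      obtain rs where rs: "rs \<in> idem_chains n" "W = flag_rel n `` {rs}"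
        using \<open>W \<in> E\<close> E_Flags by (auto simp: Flags_def elim!: quotientE)
      obtain ps where ps: "(rs, ps) \<in> flag_rel n" "\<forall>i<n. star (ps ! i) = ps ! i"
        using self_adjoint_chain_exists[OF rs(1)] by blast
      then show ?thesis
        using rs(2) equiv_class_eq[OF equiv_flag_rel ps(1)] by (auto simp: flag_rel_def)
    qed
    obtain ps where ps: "ps \<in> idem_chains n" "Y = flag_rel n `` {ps}" "\<And>i. i < n \<Longrightarrow> star (ps ! i) = ps ! i"
      using rep[OF YZ(1)] by blast
    obtain qs where qs: "qs \<in> idem_chains n" "Z = flag_rel n `` {qs}" "\<And>i. i < n \<Longrightarrow> star (qs ! i) = qs ! i"
      using rep[OF YZ(2)] by blast
    have "flag_rel n `` {map (\<lambda>p. g * p * algebra_inv g) ps} = flag_rel n `` {qs}"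
      using gY unfolding ps(2) qs(2) flag_act_class[OF g ps(1)] .
    then have "(map (\<lambda>p. g * p * algebra_inv g) ps, qs) \<in> flag_rel n"
      using qs(1) by (rule eq_equiv_class[OF _ equiv_flag_rel])
    then obtain u where u: "u \<in> algebra_units" "star u * u = 1" "map (\<lambda>p. u * p * algebra_inv u) ps = qs"
      using unitary_between_chains[OF ps(1,3) qs(1,3) g] by blast
    have "flag_act n u Y = Z"
      unfolding ps(2) qs(2) flag_act_class[OF u(1) ps(1)] u(3) ..
    with u show ?thesis by (auto simp: unitary_group_def)
  qed
  have "group_action (unitary_group star) E (\<lambda>u. restrict (flag_act n u) E)"
    by (rule group_actionI[OF group_unitary_group])
      (simp_all add: unitary_group_def closed flag_act_one flag_act_mult subsetD[OF E_Flags])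
  then show ?thesis
    unfolding E_def[symmetric] using trans
    by (auto simp: transitive_action_def transitive_action_axioms_def)
qed

end
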